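(* Suppose the ellipticity assumption and the unbounded-drift assumption (with data $\bar\Theta$, $m$, $\kappa$) stated in the context hold. Then there exist numbers $\Theta_0\ge\bar\Theta$ and $\bar\nu>0$ (independent of $u$) such that the following holds. If $u\in C^2(U)\cap C(\widetilde U)$ satisfies $Lu=0$ in $U$ and $u=0$ on $\gamma$, then there are only two possibilities. (i) One has, for all $\theta\ge\theta_0$, $$\max_{x\in \mathcal S_\theta} |u(x)|\le \Big(\max_{x\in \mathcal S_{\theta_0}} |u(x)|\Big) \min\left\{1,\exp\left( -\bar\nu\int_{\Theta_0}^\theta \kappa^{m(\zeta)}\, d\zeta\right)\right\}$$ (for $\theta<\Theta_0$ the minimum is understood to be $1$), and, consequently, $\lim_{\theta\to\infty} \big(\max_{x\in \mathcal S_{\theta}} |u(x)|\big)=0$. (ii) There exists $C>0$ depending on $u$ such that, for sufficiently large $\theta$, $$\max_{x\in \mathcal S_\theta} |u(x)| \ge C \exp\left( \bar\nu\int_{\bar\Theta}^\theta \kappa^{m(\zeta)}\, d\zeta\right),$$ and, consequently, $\lim_{\theta\to\infty} \big(\max_{x\in \mathcal S_{\theta}} |u(x)|\big)=\infty$.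
   Context: Domain. Let $X(r,\theta)=(r\cos\theta,r\sin\theta)$ for $r\ge0$, $\theta\in\mathbb R$. Fix $\theta_0\in\mathbb R$ and positive continuous functions $r_1,r_2$ on $[\theta_0,\infty)$ with $r_2(\theta+2\pi)<r_1(\theta)<r_2(\theta)$ for all $\theta\ge\theta_0$, and assume there is $r_*>0$ with $\lim_{\theta\to\infty}r_1(\theta)=\lim_{\theta\to\infty}r_2(\theta)=r_*$. Define $U=\{X(r,\theta):\theta>\theta_0,\ r_1(\theta)<r<r_2(\theta)\}$ (open and bounded), $\widetilde U=\{X(r,\theta):\theta\ge\theta_0,\ r_1(\theta)\le r\le r_2(\theta)\}$, $\gamma=\{X(r_i(\theta),\theta):\theta\ge\theta_0,\ i=1,2\}$, $\mathcal S_\theta=\{X(r,\theta): r_1(\theta)\le r\le r_2(\theta)\}$ for $\theta\ge\theta_0$, and $U_I=\{X(r,\theta):\theta\in I,\ r_1(\theta)<r<r_2(\theta)\}$ for $I\subset[\theta_0,\infty)$. Operator. $A=(a_{ij})$ is a function from $U$ to the real symmetric $2\times2$ matrices, $b:U\to\mathbb R^2$, and $Lu=-\sum_{i,j=1}^2 a_{ij}\frac{\partial^2u}{\partial x_i\partial x_j}+b\cdot\nabla u$ for $u\in C^2(U)$. Ellipticity assumption: there are constants $c_0>0$, $M_1>0$ such that $\xi^{\rm T}A(x)\xi\ge c_0|\xi|^2$ and $\mathrm{Tr}(A(x))\le M_1$ for all $x\in U$, $\xi\in\mathbb R^2$. Unbounded-drift assumption: there are a number $\bar\Theta\ge\theta_0$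 and an increasing function $m:[\bar\Theta,\infty)\to[0,\infty)$ such that $b$ is bounded on $U\cap U_{[\theta_0,\bar\Theta]}$; for any $\theta\ge\bar\Theta$, $|b(x)|\le m(\theta)$ for all $x\in U\cap\mathcal S_\theta$; $\lim_{\theta\to\infty}m(\theta)=\infty$; and there is a number $\kappa\in(0,1)$ with $\int_{\bar\Theta}^\infty\kappa^{m(\theta)}\,d\theta=\infty$. "There are only two possibilities" means that at least one of (i), (ii) holds. *)

theory Defs
  imports "HOL-Analysis.Analysis"
begin

definition polar :: "real \<Rightarrow> real \<Rightarrow> real^2" where
  "polar r \<theta> = vector [r * cos \<theta>, r * sin \<theta>]"

definition spiral_strip :: "(real \<Rightarrow> real) \<Rightarrow> (real \<Rightarrow> real) \<Rightarrow> real set \<Rightarrow> (real^2) set" where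
  "spiral_strip r1 r2 I = {polar r \<theta> | r \<theta>. \<theta> \<in> I \<and> r1 \<theta> < r \<and> r < r2 \<theta>}"

definition spiral_domain :: "real \<Rightarrow> (real \<Rightarrow> real) \<Rightarrow> (real \<Rightarrow> real) \<Rightarrow> (real^2) set" where
  "spiral_domain \<theta>0 r1 r2 = spiral_strip r1 r2 {\<theta>0<..}"

definition spiral_closed :: "real \<Rightarrow> (real \<Rightarrow> real) \<Rightarrow> (real \<Rightarrow> real) \<Rightarrow> (real^2) set" where
  "spiral_closed \<theta>0 r1 r2 = {polar r \<theta> | r \<theta>. \<theta> \<ge> \<theta>0 \<and> r1 \<theta> \<le> r \<and> r \<le> r2 \<theta>}"

definition spiral_sides :: "real \<Rightarrow> (real \<Rightarrow> real) \<Rightarrow> (real \<Rightarrow> real) \<Rightarrow> (real^2) set" where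
  "spiral_sides \<theta>0 r1 r2 =
     {polar (r1 \<theta>) \<theta> | \<theta>. \<theta> \<ge> \<theta>0} \<union> {polar (r2 \<theta>) \<theta> | \<theta>. \<theta> \<ge> \<theta>0}"

definition cross_section :: "(real \<Rightarrow> real) \<Rightarrow> (real \<Rightarrow> real) \<Rightarrow> real \<Rightarrow> (real^2) set" where
  "cross_section r1 r2 \<theta> = {polar r \<theta> | r. r1 \<theta> \<le> r \<and> r \<le> r2 \<theta>}"

text \<open>Cross sections are compact and nonempty, so for continuous \<open>u\<close> the supremum below
  is the maximum of \<open>\<bar>u\<bar>\<close>.\<close>

definition section_max ::
  "(real \<Rightarrow> real) \<Rightarrow> (real \<Rightarrow> real) \<Rightarrow> (real^2 \<Rightarrow> real) \<Rightarrow> real \<Rightarrow> real" where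
  "section_max r1 r2 u \<theta> = (SUP x \<in> cross_section r1 r2 \<theta>. \<bar>u x\<bar>)"

definition has_partial_at :: "'n::finite \<Rightarrow> (real^'n \<Rightarrow> real) \<Rightarrow> real^'n \<Rightarrow> bool" where
  "has_partial_at i u x \<longleftrightarrow> (\<lambda>t. u (x + t *\<^sub>R axis i 1)) differentiable (at 0)"

definition partial :: "'n::finite \<Rightarrow> (real^'n \<Rightarrow> real) \<Rightarrow> real^'n \<Rightarrow> real" where
  "partial i u x = deriv (\<lambda>t. u (x + t *\<^sub>R axis i 1)) 0"

text \<open>Meant for open \<open>U\<close>: all partial derivatives up to order two exist and are continuous.\<close>

definition C2_on :: "(real^'n::finite) set \<Rightarrow> (real^'n \<Rightarrow> real) \<Rightarrow> bool" where
  "C2_on U u \<longleftrightarrow> continuous_on U u \<and>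
     (\<forall>i. (\<forall>x\<in>U. has_partial_at i u x) \<and> continuous_on U (partial i u)) \<and>
     (\<forall>i j. (\<forall>x\<in>U. has_partial_at i (partial j u) x) \<and> continuous_on U (partial i (partial j u)))"

definition gradient :: "(real^'n::finite \<Rightarrow> real) \<Rightarrow> real^'n \<Rightarrow> real^'n" where
  "gradient u x = (\<chi> i. partial i u x)"

definition drift_operator ::
  "(real^2 \<Rightarrow> real^2^2) \<Rightarrow> (real^2 \<Rightarrow> real^2) \<Rightarrow> (real^2 \<Rightarrow> real) \<Rightarrow> real^2 \<Rightarrow> real" where
  "drift_operator A b u x =
     - (\<Sum>i\<in>UNIV. \<Sum>j\<in>UNIV. A x $ i $ j * partial i (partial j u) x) + b x \<bullet> gradient u x"

end

theory Submission
  imports Defs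
begin

text \<open>
Write \<open>M(\<theta>)\<close> for the maximum of \<open>\<bar>u\<bar>\<close> over the cross-section at \<open>\<theta>\<close>. Two properties of \<open>M\<close>
carry the theorem.

First, the weak maximum principle on the piece of the strip between two cross-sections says that \<open>M\<close>
on an interval is bounded by the larger of its two end values
(\<open>section_max_quasiconvex\<close>). Such a function is either nonincreasing for all \<open>\<theta> \<ge> \<theta>0\<close> or
nondecreasing from some angle on; this is the source of the two alternatives.

Second, since \<open>u\<close> vanishes on the sides and the strip becomes thin, \<open>M(\<theta>)\<close> is, far out, at most
\<open>1 - \<delta> \<kappa> powr m(\<theta> + h)\<close> times the larger of \<open>M(\<theta> - h)\<close> and \<open>M(\<theta> + h)\<close>, where \<open>h = \<pi>/2\<close>
(\<open>section_max_contraction\<close>). This is shown with the barrier \<open>exp (K \<psi>)\<close>, where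
\<open>\<psi>(x) = \<bar>x\<bar>\<^sup>2 - \<beta> (x \<bullet> \<tau>)\<^sup>2\<close> and \<open>\<tau>\<close> is the tangential direction at \<open>\<theta>\<close>. It is a strict subsolution when
\<open>K\<close> is a suitable multiple of the bound \<open>m\<close> for the drift. If \<open>\<bar>x\<bar>\<^sup>2\<close> oscillates by at most \<open>D\<close> over
the strip, a tilt \<open>\<beta>\<close> proportional to \<open>D\<close> suffices to make the barrier ineffective at the two ends, and
what is gained at the centre is about \<open>exp (- K D)\<close>. Both boundary curves tend to the same
circle, so \<open>D\<close> can be taken as small as desired far out; this is why every \<open>\<kappa> < 1\<close> is admissible.

Iterating the contraction in steps of length \<open>h\<close> along a monotone \<open>M\<close> gives decay in the first case
and growth in the second. The product of the factors is compared with the exponential of the integral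
of \<open>\<kappa> powr m\<close>, which decreases in the angle and has a divergent integral
(\<open>quasiconvex_dichotomy\<close>).

The maximum principle itself rests on \<open>no_interior_max_of_barrier_sum\<close>: at an interior maximum the
second derivative test is applied along two lines obtained from a factorisation of the coefficient
matrix.\<close>

section \<open>Derivatives along lines\<close>

lemma DERIV_line_partial:
  assumes "has_partial_at i f (x + t *\<^sub>R axis i 1)"
  shows "((\<lambda>t. f (x + t *\<^sub>R axis i 1)) has_real_derivative partial i f (x + t *\<^sub>R axis i 1)) (at t)"
proof -
  have "((\<lambda>s. f (x + t *\<^sub>R axis i 1 + s *\<^sub>R axis i 1)) has_real_derivative
      partial i f (x + t *\<^sub>R axis i 1)) (at 0)"
    using assms unfolding has_partial_at_def partial_def by (simp add: DERIV_deriv_iff_real_differentiable)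
  then have "((\<lambda>s. f (x + (t + s) *\<^sub>R axis i 1)) has_real_derivative
      partial i f (x + t *\<^sub>R axis i 1)) (at 0)"
    by (simp add: algebra_simps)
  then have "((\<lambda>s. f (x + (s + t) *\<^sub>R axis i 1)) has_real_derivative
      partial i f (x + t *\<^sub>R axis i 1)) (at 0)"
    by (simp add: add.commute)
  then show ?thesis
    using DERIV_shift[of "\<lambda>s. f (x + s *\<^sub>R axis i 1)" _ 0 t] by simp
qed

text \<open>The notion \<open>C2_on\<close> speaks of derivatives along the coordinate axes, but the second
derivative test at a maximum is needed in arbitrary directions. The bridge is the classical fact
that continuous partial derivatives give a total derivative; it follows from the criterion for
functions of a pair, applied to \<open>(s, t) \<mapsto> f (x + s e\<^sub>1 + t e\<^sub>2)\<close> on a product neighbourhood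
of the origin.\<close>

lemma C1_has_derivative:
  fixes f :: "real^2 \<Rightarrow> real"
  assumes op: "open U" and x: "x \<in> U"
    and par: "\<And>i y. y \<in> U \<Longrightarrow> has_partial_at i f y"
    and cont: "\<And>i. continuous_on U (partial i f)"
  shows "(f has_derivative (\<lambda>h. gradient f x \<bullet> h)) (at x)"
proof -
  define p where "p = (\<lambda>(s::real, t::real). x + s *\<^sub>R axis 1 1 + t *\<^sub>R (axis 2 1 :: real^2))"
  have pc: "continuous_on A p" for A
    unfolding p_def case_prod_beta by (intro continuous_intros)
  have p0: "p (0, 0) = x" by (simp add: p_def)
  have "open (p -` U)" using pc[of UNIV] op by (simp add: open_vimage)
  moreover have "(0, 0) \<in> p -` U" using x p0 by simp
  ultimately obtain X Y where XY: "open X" "open Y" "(0,0) \<in> X \<times> Y" "X \<times> Y \<subseteq> p -` U"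
    by (metis open_prod_elim)
  obtain e where e: "e > 0" "ball 0 e \<subseteq> Y" using XY by (auto simp: open_contains_ball)
  define Z :: "real set" where "Z = ball 0 e"
  have inU: "p (s, t) \<in> U" if "s \<in> X" "t \<in> Z" for s t
  proof -
    have "(s, t) \<in> X \<times> Y" using that e by (auto simp: Z_def)
    then show ?thesis using XY by blast
  qed
  have Z: "open Z" "convex Z" "0 \<in> Z" using e by (auto simp: Z_def)
  have "((\<lambda>(s, t). f (p (s, t))) has_derivative
      (\<lambda>(s, t). s * partial 1 f x + blinfun_scaleR_left (partial 2 f (p (0, 0))) t)) (at (0, 0) within X \<times> Z)"
  proof (rule has_derivative_partialsI[where fy = "\<lambda>s t. blinfun_scaleR_left (partial 2 f (p (s, t)))"])
    have "((\<lambda>s. f (x + s *\<^sub>R axis 1 1)) has_real_derivative partial 1 f x) (at 0)"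
      using DERIV_line_partial[of 1 f x 0] par[OF x] by simp
    then show "((\<lambda>s. f (p (s, 0))) has_derivative (\<lambda>s. s * partial 1 f x)) (at 0 within X)"
      by (simp add: p_def has_field_derivative_def mult_commute_abs has_derivative_at_withinI)
  next
    fix s t assume "s \<in> X" "t \<in> Z"
    then have "has_partial_at 2 f (x + s *\<^sub>R axis 1 1 + t *\<^sub>R axis 2 1)"
      using par[OF inU] by (simp add: p_def)
    from DERIV_line_partial[OF this]
    show "((\<lambda>t. f (p (s, t))) has_derivative blinfun_apply (blinfun_scaleR_left (partial 2 f (p (s, t))))) (at t within Z)"
      by (simp add: p_def has_field_derivative_def mult_commute_abs has_derivative_at_withinI)
  next
    have "continuous_on (X \<times> Z) (\<lambda>z. partial 2 f (p z))"
      using inU by (intro continuous_on_compose2[OF cont pc]) auto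
    then have "continuous_on (X \<times> Z) (\<lambda>z. blinfun_scaleR_left (partial 2 f (p z)))"
      by (intro continuous_intros)
    then show "continuous (at (0, 0) within X \<times> Z) (\<lambda>(s, t). blinfun_scaleR_left (partial 2 f (p (s, t))))"
      unfolding case_prod_unfold prod.collapse using XY Z
      by (simp add: continuous_on_eq_continuous_within)
  qed (use Z in auto)
  then have D: "((\<lambda>z. f (p z)) has_derivative
      (\<lambda>(s, t). s * partial 1 f x + t * partial 2 f x)) (at (0, 0))"
    using XY Z by (subst (asm) at_within_open) (auto simp: p0 case_prod_unfold open_Times)
  have q: "((\<lambda>y. (y $ 1 - x $ 1, y $ 2 - x $ 2)) has_derivative (\<lambda>h. (h $ 1, h $ 2))) (at x)"
    by (auto intro!: derivative_eq_intros bounded_linear_imp_has_derivative bounded_linear_vec_nth)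
  have pq: "p (y $ 1 - x $ 1, y $ 2 - x $ 2) = y" for y
    by (simp add: p_def vec_eq_iff forall_2 axis_def)
  have "((\<lambda>z. f (p z)) \<circ> (\<lambda>y. (y $ 1 - x $ 1, y $ 2 - x $ 2)) has_derivative
      (\<lambda>(s, t). s * partial 1 f x + t * partial 2 f x) \<circ> (\<lambda>h. (h $ 1, h $ 2))) (at x)"
    by (rule diff_chain_at[OF q]) (use D in simp)
  then show ?thesis
    by (simp add: o_def pq gradient_def inner_vec_def sum_2 mult.commute)
qed

lemma DERIV_along_line:
  fixes f :: "real^2 \<Rightarrow> real"
  assumes "(f has_derivative (\<lambda>h. gradient f (x + t *\<^sub>R \<xi>) \<bullet> h)) (at (x + t *\<^sub>R \<xi>))"
  shows "((\<lambda>t. f (x + t *\<^sub>R \<xi>)) has_real_derivative gradient f (x + t *\<^sub>R \<xi>) \<bullet> \<xi>) (at t)"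
proof -
  have "((\<lambda>t. x + t *\<^sub>R \<xi>) has_derivative (\<lambda>s. s *\<^sub>R \<xi>)) (at t)"
    by (auto intro!: derivative_eq_intros)
  from diff_chain_at[OF this assms] show ?thesis
    by (simp add: o_def has_field_derivative_def mult.commute[of _ "_ \<bullet> _"])
qed

text \<open>If the second derivative were positive, \<open>g'\<close> would be positive just to the right of the critical
point and \<open>g\<close> would exceed its maximum there.\<close>

lemma second_derivative_nonpos_at_max:
  fixes g :: "real \<Rightarrow> real"
  assumes "d > 0" and g: "\<And>t. \<bar>t\<bar> < d \<Longrightarrow> (g has_real_derivative g' t) (at t)"
    and g2: "(g' has_real_derivative k) (at 0)"
    and mx: "\<And>t. \<bar>t\<bar> < d \<Longrightarrow> g t \<le> g 0"
  shows "g' 0 = 0" "k \<le> 0"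
proof -
  show z: "g' 0 = 0"
    by (rule DERIV_local_max[OF g \<open>d > 0\<close>]) (use mx \<open>d > 0\<close> in auto)
  show "k \<le> 0"
  proof (rule ccontr)
    assume "\<not> k \<le> 0"
    then obtain e where e: "e > 0" "\<And>h. 0 < h \<Longrightarrow> h < e \<Longrightarrow> 0 < g' h"
      using DERIV_pos_inc_right[OF g2] z by auto
    define s where "s = min e d / 2"
    have s: "0 < s" "s < e" "s < d" using e \<open>d > 0\<close> by (auto simp: s_def)
    have "g 0 < g s"
    proof (rule DERIV_pos_imp_increasing_open[OF s(1)])
      show "continuous_on {0..s} g"
        using g s by (intro DERIV_atLeastAtMost_imp_continuous_on) (metis abs_of_nonneg le_less_trans)
    qed (use g e s in \<open>fastforce\<close>)
    with mx[of s] s show False by auto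
  qed
qed

text \<open>The chain rule, once for \<open>u\<close> and once for each of its first partial derivatives, which are again
continuously differentiable.\<close>

lemma C2_line_derivatives:
  fixes u :: "real^2 \<Rightarrow> real"
  assumes "C2_on U u" "open U" "x + t *\<^sub>R \<xi> \<in> U"
  shows "((\<lambda>t. u (x + t *\<^sub>R \<xi>)) has_real_derivative gradient u (x + t *\<^sub>R \<xi>) \<bullet> \<xi>) (at t)"
    and "((\<lambda>t. gradient u (x + t *\<^sub>R \<xi>) \<bullet> \<xi>) has_real_derivative
           (\<Sum>i\<in>UNIV. \<Sum>j\<in>UNIV. \<xi> $ i * \<xi> $ j * partial i (partial j u) (x + t *\<^sub>R \<xi>))) (at t)"
proof -
  show "((\<lambda>t. u (x + t *\<^sub>R \<xi>)) has_real_derivative gradient u (x + t *\<^sub>R \<xi>) \<bullet> \<xi>) (at t)"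
    using assms by (intro DERIV_along_line C1_has_derivative) (auto simp: C2_on_def)
  have D: "((\<lambda>t. partial j u (x + t *\<^sub>R \<xi>)) has_real_derivative
      gradient (partial j u) (x + t *\<^sub>R \<xi>) \<bullet> \<xi>) (at t)" for j
    using assms by (intro DERIV_along_line C1_has_derivative) (auto simp: C2_on_def)
  have "((\<lambda>t. partial 1 u (x + t *\<^sub>R \<xi>) * \<xi> $ 1 + partial 2 u (x + t *\<^sub>R \<xi>) * \<xi> $ 2) has_real_derivative
     (gradient (partial 1 u) (x + t *\<^sub>R \<xi>) \<bullet> \<xi>) * \<xi> $ 1 + (gradient (partial 2 u) (x + t *\<^sub>R \<xi>) \<bullet> \<xi>) * \<xi> $ 2) (at t)"
    by (intro DERIV_add DERIV_cmult_right D)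
  then show "((\<lambda>t. gradient u (x + t *\<^sub>R \<xi>) \<bullet> \<xi>) has_real_derivative
           (\<Sum>i\<in>UNIV. \<Sum>j\<in>UNIV. \<xi> $ i * \<xi> $ j * partial i (partial j u) (x + t *\<^sub>R \<xi>))) (at t)"
    by (simp add: gradient_def inner_vec_def sum_2 algebra_simps)
qed

section \<open>Exponential barriers and interior maxima\<close>

text \<open>A Cholesky factorisation. It turns the second-order part of the operator into a sum of second
derivatives along the two lines with directions \<open>\<xi>\<close> and \<open>\<eta>\<close>, to which the one-variable
second derivative test applies, while the same vectors also compute the quadratic form of the
matrix.\<close>

lemma positive_definite_2x2_as_squares:
  fixes A :: "real^2^2"
  assumes sym: "transpose A = A" and c0: "c0 > 0"
    and pos: "\<And>\<xi>. \<xi> \<bullet> (A *v \<xi>) \<ge> c0 * (norm \<xi>)\<^sup>2"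
  obtains \<xi> \<eta> :: "real^2" where "\<And>i j. A $ i $ j = \<xi> $ i * \<xi> $ j + \<eta> $ i * \<eta> $ j"
proof -
  define a p d where "a = A $ 1 $ 1" and "p = A $ 1 $ 2" and "d = A $ 2 $ 2"
  have p': "A $ 2 $ 1 = p" using arg_cong[OF sym, of "\<lambda>M. M $ 1 $ 2"] by (simp add: transpose_def p_def)
  have Q: "vector [s, t] \<bullet> (A *v vector [s, t]) = a * s\<^sup>2 + 2 * p * s * t + d * t\<^sup>2" for s t
    by (simp add: inner_vec_def matrix_vector_mult_def sum_2 p' a_def p_def d_def power2_eq_square algebra_simps)
  have ge0: "a * s\<^sup>2 + 2 * p * s * t + d * t\<^sup>2 \<ge> c0 * (s\<^sup>2 + t\<^sup>2)" for s t
  proof -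
    have "(norm (vector [s, t] :: real^2))\<^sup>2 = s\<^sup>2 + t\<^sup>2"
      unfolding power2_norm_eq_inner by (simp add: inner_vec_def sum_2 power2_eq_square)
    with pos[of "vector [s, t]"] show ?thesis unfolding Q by simp
  qed
  have a: "a > 0" using ge0[of 1 0] c0 by simp
  \<comment> \<open>The value of the form at \<open>(p, - a)\<close> is \<open>a\<close> times the determinant.\<close>
  have "0 \<le> c0 * (p\<^sup>2 + a\<^sup>2)" using c0 by simp
  also have "\<dots> \<le> a * p\<^sup>2 + 2 * p * p * (- a) + d * a\<^sup>2" using ge0[of p "- a"] by simp
  also have "\<dots> = a * (a * d - p\<^sup>2)" by (simp add: power2_eq_square algebra_simps)
  finally have "a * d - p\<^sup>2 \<ge> 0" using a by (simp add: zero_le_mult_iff)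
  then have d: "d - p\<^sup>2 / a \<ge> 0" using a by (simp add: field_simps)
  define \<xi> \<eta> :: "real^2" where "\<xi> = vector [sqrt a, p / sqrt a]" and "\<eta> = vector [0, sqrt (d - p\<^sup>2 / a)]"
  have "A $ i $ j = \<xi> $ i * \<xi> $ j + \<eta> $ i * \<eta> $ j" for i j
    using exhaust_2[of i] exhaust_2[of j] a d p'
    by (auto simp: \<xi>_def \<eta>_def a_def[symmetric] p_def[symmetric] d_def[symmetric] power2_eq_square)
  then show ?thesis by (rule that)
qed

text \<open>The exponent of the barriers \<open>exp (K \<psi>)\<close>. Along the spiral \<open>\<bar>x\<bar>\<^sup>2\<close> is nearly constant, so
the penalty in the direction \<open>\<tau>\<close>, which is chosen tangential, decides how fast the barrier decays
away from a given cross-section.\<close>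

definition tilted_square :: "real \<Rightarrow> real^2 \<Rightarrow> real^2 \<Rightarrow> real" where
  "tilted_square \<beta> \<tau> x = x \<bullet> x - \<beta> * (x \<bullet> \<tau>)\<^sup>2"

lemma inner_square_le:
  fixes x \<tau> :: "'a::real_inner"
  assumes "norm \<tau> = 1" shows "(x \<bullet> \<tau>)\<^sup>2 \<le> x \<bullet> x"
  using Cauchy_Schwarz_ineq[of x \<tau>] assms by (simp add: norm_eq_1)

text \<open>The barrier \<open>v = c exp (K \<psi>)\<close> is a strict subsolution as soon as \<open>K\<close> dominates the drift: \<open>\<psi>\<close>
is convex because \<open>\<beta> \<le> 1\<close>, so the second-order part of \<open>- L v\<close> is at least
\<open>v K\<^sup>2 c\<^sub>0 \<bar>\<nabla>\<psi>\<bar>\<^sup>2\<close>, whereas the drift contributes at most \<open>v K \<bar>b\<bar> \<bar>\<nabla>\<psi>\<bar>\<close>; and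
\<open>\<bar>\<nabla>\<psi>\<bar> \<ge> \<bar>x\<bar>\<close> because \<open>\<beta> \<le> 1/2\<close>. At an interior maximum of \<open>\<sigma> u + v\<close>, with \<open>L u = 0\<close>, the
first and second derivative tests would force the opposite inequality. In the proof \<open>G\<close> is the
gradient of \<open>\<psi>\<close>, \<open>E\<close> is the value of \<open>v\<close> and \<open>Q\<close> is the Hessian form of \<open>u\<close>, all at \<open>x\<close>.\<close>

lemma no_interior_max_of_barrier_sum:
  fixes u :: "real^2 \<Rightarrow> real"
  assumes U: "open U" "x \<in> U" and u: "C2_on U u" "drift_operator A b u x = 0"
    and A: "transpose (A x) = A x" "c0 > 0" "\<And>\<xi>. \<xi> \<bullet> (A x *v \<xi>) \<ge> c0 * (norm \<xi>)\<^sup>2"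
    and \<tau>: "norm \<tau> = 1" and \<beta>: "0 \<le> \<beta>" "\<beta> \<le> 1/2" and c: "c > 0"
    and K: "K > 0" "norm (b x) < K * c0 * norm x"
    and mx: "\<forall>\<^sub>F y in nhds x. \<sigma> * u y + c * exp (K * tilted_square \<beta> \<tau> y)
                 \<le> \<sigma> * u x + c * exp (K * tilted_square \<beta> \<tau> x)"
  shows False
proof -
  define E where "E = c * exp (K * tilted_square \<beta> \<tau> x)"
  define G where "G = 2 *\<^sub>R (x - (\<beta> * (x \<bullet> \<tau>)) *\<^sub>R \<tau>)"
  define Q where "Q \<zeta> = (\<Sum>i\<in>UNIV. \<Sum>j\<in>UNIV. \<zeta> $ i * \<zeta> $ j * partial i (partial j u) x)" for \<zeta>
  have E: "E > 0" using c by (simp add: E_def)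
  have line: "\<sigma> * (gradient u x \<bullet> \<zeta>) + E * K * (G \<bullet> \<zeta>) = 0 \<and> \<sigma> * Q \<zeta> + E * K\<^sup>2 * (G \<bullet> \<zeta>)\<^sup>2 \<le> 0" for \<zeta>
  proof -
    define s where "s = tilted_square \<beta> \<tau> \<zeta>"
    have s: "s \<ge> 0"
    proof -
      have "\<beta> * (\<zeta> \<bullet> \<tau>)\<^sup>2 \<le> 1 * (\<zeta> \<bullet> \<tau>)\<^sup>2" using \<beta> by (intro mult_right_mono) auto
      then show ?thesis using inner_square_le[OF \<tau>, of \<zeta>] by (simp add: s_def tilted_square_def)
    qed
    \<comment> \<open>As \<open>\<psi>\<close> is quadratic, its restriction to a line is an explicit polynomial.\<close>
    have ps: "tilted_square \<beta> \<tau> (x + t *\<^sub>R \<zeta>) = tilted_square \<beta> \<tau> x + t * (G \<bullet> \<zeta>) + t\<^sup>2 * s" for t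
      by (simp add: tilted_square_def s_def G_def inner_simps power2_eq_square algebra_simps inner_commute)
    define e where "e = (\<lambda>t. c * exp (K * (tilted_square \<beta> \<tau> x + t * (G \<bullet> \<zeta>) + t\<^sup>2 * s)))"
    define e' where "e' = (\<lambda>t. e t * (K * ((G \<bullet> \<zeta>) + 2 * t * s)))"
    have e0: "e 0 = E" by (simp add: e_def E_def)
    have De: "(e has_real_derivative e' t) (at t)" for t
      unfolding e'_def e_def by (auto intro!: derivative_eq_intros simp: algebra_simps)
    have De': "(e' has_real_derivative E * K\<^sup>2 * (G \<bullet> \<zeta>)\<^sup>2 + E * K * (2 * s)) (at 0)"
      unfolding e'_def by (auto intro!: derivative_eq_intros De simp: e0 e'_def power2_eq_square algebra_simps)
    obtain d0 where d0: "d0 > 0" "\<And>y. dist y x < d0 \<Longrightarrow> y \<in> U \<and> \<sigma> * u y + c * exp (K * tilted_square \<beta> \<tau> y)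
                 \<le> \<sigma> * u x + c * exp (K * tilted_square \<beta> \<tau> x)"
      using eventually_conj[OF eventually_nhds_in_open[OF U] mx] unfolding eventually_nhds_metric by blast
    define d where "d = d0 / (norm \<zeta> + 1)"
    have d: "d > 0" using d0 by (simp add: d_def add_nonneg_pos)
    have near: "dist (x + t *\<^sub>R \<zeta>) x < d0" if "\<bar>t\<bar> < d" for t
    proof -
      have "\<bar>t\<bar> * norm \<zeta> \<le> \<bar>t\<bar> * (norm \<zeta> + 1)" by (intro mult_left_mono) auto
      also have "\<dots> < d0" using that by (simp add: d_def pos_less_divide_eq add_nonneg_pos)
      finally show ?thesis by (simp add: dist_norm)
    qed
    define g where "g t = \<sigma> * u (x + t *\<^sub>R \<zeta>) + e t" for t
    define g' where "g' t = \<sigma> * (gradient u (x + t *\<^sub>R \<zeta>) \<bullet> \<zeta>) + e' t" for t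
    have Dg: "(g has_real_derivative g' t) (at t)" if "\<bar>t\<bar> < d" for t
      unfolding g_def g'_def
      by (intro DERIV_add DERIV_cmult De C2_line_derivatives(1)[OF u(1) U(1)]) (use near[OF that] d0 in auto)
    have Dg': "(g' has_real_derivative \<sigma> * Q \<zeta> + (E * K\<^sup>2 * (G \<bullet> \<zeta>)\<^sup>2 + E * K * (2 * s))) (at 0)"
      unfolding g'_def Q_def
      by (intro DERIV_add DERIV_cmult De') (use C2_line_derivatives(2)[OF u(1) U(1), of x 0 \<zeta>] U in auto)
    have "g t \<le> g 0" if "\<bar>t\<bar> < d" for t
      using d0(2)[OF near[OF that]] by (simp add: g_def e_def ps)
    from second_derivative_nonpos_at_max[OF d Dg Dg' this]
    have "g' 0 = 0" "\<sigma> * Q \<zeta> + (E * K\<^sup>2 * (G \<bullet> \<zeta>)\<^sup>2 + E * K * (2 * s)) \<le> 0" by auto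
    moreover have "E * K * (2 * s) \<ge> 0" using E K s by simp
    ultimately show ?thesis by (simp add: g'_def e'_def e0 mult.assoc)
  qed
  obtain \<xi> \<eta> :: "real^2" where sq: "\<And>i j. A x $ i $ j = \<xi> $ i * \<xi> $ j + \<eta> $ i * \<eta> $ j"
    using positive_definite_2x2_as_squares[OF A] by blast
  have tr: "(\<Sum>i\<in>UNIV. \<Sum>j\<in>UNIV. A x $ i $ j * partial i (partial j u) x) = Q \<xi> + Q \<eta>"
    by (simp add: Q_def sum_2 sq algebra_simps)
  have quad: "G \<bullet> (A x *v G) = (G \<bullet> \<xi>)\<^sup>2 + (G \<bullet> \<eta>)\<^sup>2"
    by (simp add: inner_vec_def matrix_vector_mult_def sum_2 sq power2_eq_square algebra_simps)
  have x: "norm x > 0"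
    using K(2) norm_ge_zero[of "b x"] by (metis mult_zero_right norm_ge_zero less_le not_le)
  have Gx: "norm G \<ge> norm x"
  proof -
    have "\<beta> * (x \<bullet> \<tau>)\<^sup>2 \<le> 1/2 * (x \<bullet> x)" using \<beta> inner_square_le[OF \<tau>, of x] by (intro mult_mono) auto
    then have "x \<bullet> x \<le> G \<bullet> x" by (simp add: G_def inner_simps power2_eq_square inner_commute algebra_simps)
    also have "\<dots> \<le> norm G * norm x" by (rule norm_cauchy_schwarz)
    finally show ?thesis using x by (simp add: dot_square_norm power2_eq_square)
  qed
  have b: "norm (b x) * norm G < K * c0 * (norm G)\<^sup>2"
  proof -
    have "K * c0 * norm x \<le> K * c0 * norm G" using K A Gx by (intro mult_left_mono) auto
    then have "norm (b x) < K * c0 * norm G" using K(2) by linarith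
    then have "norm (b x) * norm G < K * c0 * norm G * norm G" using x Gx by (intro mult_strict_right_mono) auto
    then show ?thesis by (simp add: power2_eq_square mult.assoc)
  qed
  have "0 = \<sigma> * drift_operator A b u x" using u by simp
  also have "\<dots> = - (\<sigma> * Q \<xi> + \<sigma> * Q \<eta>) + \<sigma> * (gradient u x \<bullet> b x)"
    unfolding drift_operator_def tr by (simp add: algebra_simps inner_commute)
  also have "\<dots> \<ge> E * K\<^sup>2 * (G \<bullet> (A x *v G)) - E * K * (G \<bullet> b x)"
    using line[of \<xi>] line[of \<eta>] line[of "b x"] unfolding quad by (simp add: algebra_simps)
  finally have "E * K * (K * (G \<bullet> (A x *v G))) \<le> E * K * (G \<bullet> b x)"
    by (simp add: power2_eq_square mult.assoc)
  then have "K * (G \<bullet> (A x *v G)) \<le> G \<bullet> b x" using E K by simp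
  also have "\<dots> \<le> norm (b x) * norm G" by (metis mult.commute norm_cauchy_schwarz)
  also have "\<dots> < K * (c0 * (norm G)\<^sup>2)" using b by (simp add: mult.assoc)
  also have "\<dots> \<le> K * (G \<bullet> (A x *v G))" using K A(3)[of G] by simp
  finally show False by simp
qed

section \<open>Spiral strips in polar coordinates\<close>

lemma polar_nth [simp]: "polar r \<phi> $ 1 = r * cos \<phi>" "polar r \<phi> $ 2 = r * sin \<phi>"
  by (simp_all add: polar_def)

lemma inner_polar: "polar r \<phi> \<bullet> polar s \<psi> = r * s * cos (\<phi> - \<psi>)"
  by (simp add: inner_vec_def sum_2 cos_diff algebra_simps)

lemma norm_polar: "norm (polar r \<phi>) = \<bar>r\<bar>"
  by (simp add: norm_eq_sqrt_inner inner_polar)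

lemma polar_eq_sum: "polar r \<phi> = (r * cos \<phi>) *\<^sub>R axis 1 1 + (r * sin \<phi>) *\<^sub>R axis 2 1"
  by (simp add: vec_eq_iff forall_2 axis_def)

lemma continuous_on_polar:
  fixes S :: "'a::t2_space set"
  assumes "continuous_on S f" "continuous_on S g"
  shows "continuous_on S (\<lambda>x. polar (f x) (g x))"
  unfolding polar_eq_sum by (intro continuous_intros assms)

text \<open>An explicit branch of the angle on the half-plane around the direction \<open>\<phi>\<close>, continuous in \<open>y\<close>.
Near a point of a strip it turns the inequalities that define the strip into open conditions on
\<open>y\<close>.\<close>

lemma polar_coordinates_near:
  assumes "y \<bullet> polar 1 \<phi> > 0"
  shows "polar (norm y) (\<phi> + arctan (y \<bullet> polar 1 (\<phi> + pi/2) / (y \<bullet> polar 1 \<phi>))) = y"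
proof -
  define p q where "p = y \<bullet> polar 1 \<phi>" and "q = y \<bullet> polar 1 (\<phi> + pi/2)"
  have pq: "p = y $ 1 * cos \<phi> + y $ 2 * sin \<phi>" "q = y $ 2 * cos \<phi> - y $ 1 * sin \<phi>"
    by (simp_all add: p_def q_def inner_vec_def sum_2 cos_add sin_add)
  have cs: "cos \<phi> * cos \<phi> = 1 - sin \<phi> * sin \<phi>"
    using sin_cos_squared_add[of \<phi>] by (simp add: power2_eq_square)
  have y: "y $ 1 = p * cos \<phi> - q * sin \<phi>" "y $ 2 = p * sin \<phi> + q * cos \<phi>"
    using cs unfolding pq by algebra+
  have p: "p > 0" using assms by (simp add: p_def)
  have "(norm y)\<^sup>2 = p\<^sup>2 + q\<^sup>2"
    unfolding power2_norm_eq_inner by (simp add: inner_vec_def sum_2 y power2_eq_square algebra_simps cs)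
  also have "\<dots> = p\<^sup>2 * (1 + (q / p)\<^sup>2)" using p by (simp add: field_simps)
  finally have n: "norm y = p * sqrt (1 + (q / p)\<^sup>2)"
    using p by (metis real_sqrt_abs abs_norm_cancel real_sqrt_mult abs_of_pos)
  have nz: "sqrt (1 + (q / p)\<^sup>2) > 0" by (simp add: add_pos_nonneg)
  have "norm y * cos (arctan (q / p)) = p" "norm y * sin (arctan (q / p)) = q"
    using p nz by (auto simp: cos_arctan sin_arctan n)
  then have "polar (norm y) (\<phi> + arctan (q / p)) = y"
    by (simp add: vec_eq_iff forall_2 cos_add sin_add y distrib_left right_diff_distrib mult.left_commute[of "norm y"])
  then show ?thesis by (simp add: p_def q_def)
qed

lemma open_spiral_strip:
  assumes I: "open I" and cont: "continuous_on I r1" "continuous_on I r2"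
    and pos: "\<And>\<phi>. \<phi> \<in> I \<Longrightarrow> 0 < r1 \<phi>"
  shows "open (spiral_strip r1 r2 I)"
proof -
  have "\<exists>T. open T \<and> x \<in> T \<and> T \<subseteq> spiral_strip r1 r2 I" if xI: "x \<in> spiral_strip r1 r2 I" for x
  proof -
    obtain r \<phi> where x: "x = polar r \<phi>" "\<phi> \<in> I" "r1 \<phi> < r" "r < r2 \<phi>"
      using xI unfolding spiral_strip_def by blast
    have r: "r > 0" using x pos[of \<phi>] by auto
    define \<alpha> where "\<alpha> y = \<phi> + arctan (y \<bullet> polar 1 (\<phi> + pi/2) / (y \<bullet> polar 1 \<phi>))" for y
    have \<alpha>x: "\<alpha> x = \<phi>" by (simp add: \<alpha>_def x inner_polar)
    define H where "H = {y. 0 < y \<bullet> polar 1 \<phi>}"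
    have H: "open H" unfolding H_def by (intro open_Collect_less continuous_intros)
    have c\<alpha>: "continuous_on H \<alpha>"
      unfolding \<alpha>_def H_def by (intro continuous_intros) auto
    define J where "J = H \<inter> \<alpha> -` I"
    have J: "open J" unfolding J_def
      by (rule continuous_open_preimage[OF c\<alpha> H I])
    have "continuous_on J (\<lambda>y. r1 (\<alpha> y))" "continuous_on J (\<lambda>y. r2 (\<alpha> y))"
      using cont c\<alpha> by (auto simp: J_def intro: continuous_on_compose2 continuous_on_subset)
    then have "continuous_on J (\<lambda>y. min (norm y - r1 (\<alpha> y)) (r2 (\<alpha> y) - norm y))"
      by (intro continuous_intros)
    then have o: "open (J \<inter> (\<lambda>y. min (norm y - r1 (\<alpha> y)) (r2 (\<alpha> y) - norm y)) -` {0<..})"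
      using J by (rule continuous_open_preimage) simp
    moreover have "x \<in> J" using x r \<alpha>x by (simp add: J_def H_def inner_polar)
    moreover have "norm x = r" using x r by (simp add: norm_polar)
    moreover have "y \<in> spiral_strip r1 r2 I" if "y \<in> J" "r1 (\<alpha> y) < norm y" "norm y < r2 (\<alpha> y)" for y
    proof -
      have "y = polar (norm y) (\<alpha> y)"
        using polar_coordinates_near[of y \<phi>] that by (simp add: J_def H_def \<alpha>_def)
      moreover have "\<alpha> y \<in> I" using that by (simp add: J_def)
      ultimately show ?thesis using that unfolding spiral_strip_def by blast
    qed
    ultimately show ?thesis using x \<alpha>x
      by (intro exI[of _ "J \<inter> (\<lambda>y. min (norm y - r1 (\<alpha> y)) (r2 (\<alpha> y) - norm y)) -` {0<..}"]) auto
  qed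
  then show ?thesis by (subst open_subopen) blast
qed

text \<open>The regions between two curves winding around the origin. A point enters only
through some polar representation, never through a chosen value of its angle.\<close>

locale spiral =
  fixes \<theta>0 :: real and r1 r2 :: "real \<Rightarrow> real"
  assumes r_cont: "continuous_on {\<theta>0..} r1" "continuous_on {\<theta>0..} r2"
    and r1_pos: "\<And>\<phi>. \<phi> \<ge> \<theta>0 \<Longrightarrow> 0 < r1 \<phi>"
    and r1_less_r2: "\<And>\<phi>. \<phi> \<ge> \<theta>0 \<Longrightarrow> r1 \<phi> < r2 \<phi>"
begin

definition sector :: "real \<Rightarrow> real \<Rightarrow> (real^2) set" where
  "sector a c = {polar r \<phi> | r \<phi>. a \<le> \<phi> \<and> \<phi> \<le> c \<and> r1 \<phi> \<le> r \<and> r \<le> r2 \<phi>}"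

lemma open_domain: "open (spiral_domain \<theta>0 r1 r2)"
  unfolding spiral_domain_def
  by (rule open_spiral_strip) (auto intro: continuous_on_subset r_cont r1_pos)

text \<open>The segments between \<open>r1 \<phi>\<close> and \<open>r2 \<phi>\<close> are rescaled to the unit interval, which presents the
sector as a continuous image of a rectangle.\<close>

lemma compact_sector:
  assumes "\<theta>0 \<le> a" shows "compact (sector a c)"
proof -
  let ?P = "\<lambda>(s, \<phi>). polar ((1 - s) * r1 \<phi> + s * r2 \<phi>) \<phi>"
  have "sector a c = ?P ` ({0..1} \<times> {a..c})"
  proof (intro equalityI subsetI)
    fix x assume "x \<in> sector a c"
    then obtain r \<phi> where x: "x = polar r \<phi>" "a \<le> \<phi>" "\<phi> \<le> c" "r1 \<phi> \<le> r" "r \<le> r2 \<phi>"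
      by (auto simp: sector_def)
    define s where "s = (r - r1 \<phi>) / (r2 \<phi> - r1 \<phi>)"
    have d: "r2 \<phi> - r1 \<phi> > 0" using r1_less_r2[of \<phi>] x assms by auto
    then have "s * (r2 \<phi> - r1 \<phi>) = r - r1 \<phi>" by (simp add: s_def)
    then have "(1 - s) * r1 \<phi> + s * r2 \<phi> = r" by (simp add: algebra_simps)
    moreover have "0 \<le> s" "s \<le> 1" using d x by (auto simp: s_def)
    ultimately show "x \<in> ?P ` ({0..1} \<times> {a..c})" using x by (intro image_eqI[of _ _ "(s, \<phi>)"]) auto
  next
    fix x assume "x \<in> ?P ` ({0..1} \<times> {a..c})"
    then obtain s \<phi> where x: "x = ?P (s, \<phi>)" "0 \<le> s" "s \<le> 1" "a \<le> \<phi>" "\<phi> \<le> c" by auto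
    have "r1 \<phi> \<le> r2 \<phi>" using r1_less_r2[of \<phi>] x assms by auto
    then have "s * r1 \<phi> \<le> s * r2 \<phi>" "(1 - s) * r1 \<phi> \<le> (1 - s) * r2 \<phi>" using x by (auto intro: mult_left_mono)
    then have "r1 \<phi> \<le> (1 - s) * r1 \<phi> + s * r2 \<phi>" "(1 - s) * r1 \<phi> + s * r2 \<phi> \<le> r2 \<phi>"
      by (auto simp: algebra_simps)
    then show "x \<in> sector a c" using x unfolding sector_def by auto
  qed
  moreover have "continuous_on ({0..1} \<times> {a..c}) ?P"
    unfolding case_prod_beta using assms
    by (intro continuous_on_polar continuous_intros continuous_on_compose2[OF r_cont(1)] continuous_on_compose2[OF r_cont(2)]) auto
  ultimately show ?thesis
    by (simp add: compact_continuous_image compact_Times)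
qed

lemma sector_subset: "\<theta>0 \<le> a \<Longrightarrow> sector a c \<subseteq> spiral_closed \<theta>0 r1 r2"
  by (force simp: sector_def spiral_closed_def)

lemma sector_nonempty: assumes "\<theta>0 \<le> a" "a \<le> c" shows "sector a c \<noteq> {}"
  using r1_less_r2[of a] assms unfolding sector_def by force

lemma sector_singleton: "sector a a = cross_section r1 r2 a"
  by (auto simp: sector_def cross_section_def)

context
  fixes u :: "real^2 \<Rightarrow> real" and \<theta> :: real
  assumes u: "continuous_on (spiral_closed \<theta>0 r1 r2) u" and \<theta>: "\<theta>0 \<le> \<theta>"
begin

lemma section_max_upper:
  assumes "r1 \<theta> \<le> r" "r \<le> r2 \<theta>"
  shows "\<bar>u (polar r \<theta>)\<bar> \<le> section_max r1 r2 u \<theta>"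
  unfolding section_max_def
proof (rule cSUP_upper)
  show "polar r \<theta> \<in> cross_section r1 r2 \<theta>" using assms by (auto simp: cross_section_def)
  have "continuous_on (cross_section r1 r2 \<theta>) (\<lambda>x. \<bar>u x\<bar>)"
    using continuous_on_subset[OF u sector_subset[OF \<theta>, of \<theta>]]
    by (intro continuous_intros) (simp add: sector_singleton)
  then show "bdd_above ((\<lambda>x. \<bar>u x\<bar>) ` cross_section r1 r2 \<theta>)"
    using compact_sector[OF \<theta>, of \<theta>]
    by (intro bounded_imp_bdd_above compact_imp_bounded compact_continuous_image) (simp_all add: sector_singleton)
qed

lemma section_max_least:
  assumes "\<And>r. r1 \<theta> \<le> r \<Longrightarrow> r \<le> r2 \<theta> \<Longrightarrow> \<bar>u (polar r \<theta>)\<bar> \<le> N"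
  shows "section_max r1 r2 u \<theta> \<le> N"
  unfolding section_max_def
  by (rule cSUP_least) (use assms sector_nonempty[OF \<theta>, of \<theta>] in \<open>auto simp: sector_singleton cross_section_def\<close>)

lemma section_max_nonneg: "0 \<le> section_max r1 r2 u \<theta>"
  using section_max_upper[of "r1 \<theta>"] r1_less_r2[OF \<theta>] by (meson abs_ge_zero less_imp_le order.refl order_trans)

end

end

section \<open>Maximum principle and contraction on cross-sections\<close>

text \<open>The qualitative theory uses the drift only through its boundedness on every bounded range of
angles; the growth rate \<open>m\<close> enters later, through the choice of \<open>K\<close> in the contraction
estimate.\<close>

locale spiral_equation = spiral +
  fixes A :: "real^2 \<Rightarrow> real^2^2" and b :: "real^2 \<Rightarrow> real^2" and c0 :: real
  assumes A_sym: "\<And>x. x \<in> spiral_domain \<theta>0 r1 r2 \<Longrightarrow> transpose (A x) = A x"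
    and c0_pos: "c0 > 0"
    and elliptic: "\<And>x \<xi>. x \<in> spiral_domain \<theta>0 r1 r2 \<Longrightarrow> \<xi> \<bullet> (A x *v \<xi>) \<ge> c0 * (norm \<xi>)\<^sup>2"
    and drift_bounded: "\<And>T. \<exists>B\<ge>0. \<forall>x \<in> spiral_strip r1 r2 {\<theta>0<..<T}. norm (b x) \<le> B"
begin

definition solution :: "(real^2 \<Rightarrow> real) \<Rightarrow> bool" where
  "solution u \<longleftrightarrow> C2_on (spiral_domain \<theta>0 r1 r2) u \<and> continuous_on (spiral_closed \<theta>0 r1 r2) u \<and>
     (\<forall>x \<in> spiral_domain \<theta>0 r1 r2. drift_operator A b u x = 0) \<and> (\<forall>x \<in> spiral_sides \<theta>0 r1 r2. u x = 0)"

text \<open>Comparison on a truncated strip. The maximum of \<open>\<sigma> u\<close> plus barrier over the compact sector is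
attained, and not in the interior; on the two spiral sides \<open>u\<close> vanishes, so there only the barrier
has to be controlled. The sign \<open>\<sigma>\<close> lets one statement serve both \<open>u\<close> and \<open>- u\<close>.\<close>

lemma barrier_max_principle:
  assumes u: "solution u" and ac: "\<theta>0 \<le> a" "a \<le> c"
    and K: "K > 0" "\<And>x. x \<in> spiral_strip r1 r2 {a<..<c} \<Longrightarrow> norm (b x) < K * c0 * norm x"
    and \<tau>: "norm \<tau> = 1" and \<beta>: "0 \<le> \<beta>" "\<beta> \<le> 1/2" and k: "k > 0"
    and sides: "\<And>\<phi> r. a \<le> \<phi> \<Longrightarrow> \<phi> \<le> c \<Longrightarrow> r = r1 \<phi> \<or> r = r2 \<phi> \<Longrightarrow>
        k * exp (K * tilted_square \<beta> \<tau> (polar r \<phi>)) \<le> N"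
    and ends: "\<And>\<phi> r. \<phi> = a \<or> \<phi> = c \<Longrightarrow> r1 \<phi> \<le> r \<Longrightarrow> r \<le> r2 \<phi> \<Longrightarrow>
        \<sigma> * u (polar r \<phi>) + k * exp (K * tilted_square \<beta> \<tau> (polar r \<phi>)) \<le> N"
    and p: "a \<le> \<phi>" "\<phi> \<le> c" "r1 \<phi> \<le> r" "r \<le> r2 \<phi>"
  shows "\<sigma> * u (polar r \<phi>) + k * exp (K * tilted_square \<beta> \<tau> (polar r \<phi>)) \<le> N"
proof -
  define f where "f y = \<sigma> * u y + k * exp (K * tilted_square \<beta> \<tau> y)" for y
  have "continuous_on (sector a c) u"
    using u sector_subset[OF ac(1)] by (auto simp: solution_def intro: continuous_on_subset)
  then have "continuous_on (sector a c) f"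
    unfolding f_def tilted_square_def by (intro continuous_intros)
  then obtain x where x: "x \<in> sector a c" "\<And>y. y \<in> sector a c \<Longrightarrow> f y \<le> f x"
    using continuous_attains_sup[OF compact_sector[OF ac(1)] sector_nonempty[OF ac]] by metis
  obtain s \<psi> where xs: "x = polar s \<psi>" "a \<le> \<psi>" "\<psi> \<le> c" "r1 \<psi> \<le> s" "s \<le> r2 \<psi>"
    using x(1) by (auto simp: sector_def)
  have "f x \<le> N"
  proof (cases "s = r1 \<psi> \<or> s = r2 \<psi> \<or> \<psi> = a \<or> \<psi> = c")
    case True
    show ?thesis
    proof (cases "s = r1 \<psi> \<or> s = r2 \<psi>")
      case True
      then have "x \<in> spiral_sides \<theta>0 r1 r2" using xs ac by (auto simp: spiral_sides_def)
      then have "u x = 0" using u by (simp add: solution_def)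
      then show ?thesis using sides[OF xs(2,3) True] by (simp add: f_def xs)
    next
      case False
      then show ?thesis using True ends[of \<psi> s] xs by (auto simp: f_def)
    qed
  next
    case False
    let ?S = "spiral_strip r1 r2 {a<..<c}"
    have xS: "x \<in> ?S" using False xs by (force simp: spiral_strip_def)
    have SU: "?S \<subseteq> spiral_domain \<theta>0 r1 r2"
      using ac by (force simp: spiral_strip_def spiral_domain_def)
    have "?S \<subseteq> sector a c" by (force simp: spiral_strip_def sector_def)
    moreover have "open ?S"
      by (rule open_spiral_strip) (use ac in \<open>auto intro: continuous_on_subset r_cont r1_pos\<close>)
    ultimately have mx: "\<forall>\<^sub>F y in nhds x. f y \<le> f x"
      using eventually_nhds_in_open[OF _ xS] x(2) by (auto elim!: eventually_mono)
    have False
      by (rule no_interior_max_of_barrier_sum[OF open_domain, where x = x and u = u and A = A and b = b and c = k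
            and K = K and \<beta> = \<beta> and \<tau> = \<tau> and \<sigma> = \<sigma>])
        (use mx[unfolded f_def] u xS SU A_sym c0_pos elliptic \<tau> \<beta> k K in \<open>auto simp: solution_def\<close>)
    then show ?thesis ..
  qed
  moreover have "f (polar r \<phi>) \<le> f x" using x(2) p by (auto simp: sector_def)
  ultimately show ?thesis by (simp add: f_def)
qed

lemma sector_norm_lower:
  assumes "\<theta>0 \<le> a"
  obtains \<rho> where "\<rho> > 0" "\<And>x. x \<in> sector a c \<Longrightarrow> \<rho> \<le> norm x"
proof (cases "sector a c = {}")
  case False
  have "continuous_on (sector a c) norm" by (intro continuous_intros)
  then obtain x where x: "x \<in> sector a c" "\<And>y. y \<in> sector a c \<Longrightarrow> norm x \<le> norm y"
    using continuous_attains_inf[OF compact_sector[OF assms] False] by metis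
  obtain r \<phi> where "x = polar r \<phi>" "a \<le> \<phi>" "r1 \<phi> \<le> r"
    using x(1) by (auto simp: sector_def)
  then have "norm x > 0" using r1_pos[of \<phi>] assms by (simp add: norm_polar)
  then show ?thesis using x that by blast
qed (use that[of 1] in auto)

text \<open>The weak maximum principle: an arbitrarily small multiple of the untilted barrier (\<open>\<beta> = 0\<close>) is
added to \<open>\<plusminus> u\<close> and then removed by letting its size \<open>e\<close> tend to zero.\<close>

lemma section_max_quasiconvex:
  assumes u: "solution u" and ac: "\<theta>0 \<le> a" "a \<le> \<phi>" "\<phi> \<le> c"
  shows "section_max r1 r2 u \<phi> \<le> max (section_max r1 r2 u a) (section_max r1 r2 u c)" (is "_ \<le> ?N")
proof -
  have uc: "continuous_on (spiral_closed \<theta>0 r1 r2) u" using u by (simp add: solution_def)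
  obtain \<rho> where \<rho>: "\<rho> > 0" "\<And>x. x \<in> sector a c \<Longrightarrow> \<rho> \<le> norm x"
    using sector_norm_lower[of a c] ac by auto
  obtain R where R: "\<And>x. x \<in> sector a c \<Longrightarrow> norm x \<le> R"
    using compact_imp_bounded[OF compact_sector[OF ac(1)]] unfolding bounded_iff by blast
  obtain B where B: "B \<ge> 0" "\<And>x. x \<in> spiral_strip r1 r2 {\<theta>0<..<c} \<Longrightarrow> norm (b x) \<le> B"
    using drift_bounded by blast
  define K where "K = (B + 1) / (c0 * \<rho>)"
  have K: "K > 0" using B \<rho> c0_pos by (simp add: K_def)
  have Kb: "norm (b x) < K * c0 * norm x" if "x \<in> spiral_strip r1 r2 {a<..<c}" for x
  proof -
    have "x \<in> spiral_strip r1 r2 {\<theta>0<..<c}" "x \<in> sector a c"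
      using that ac by (force simp: spiral_strip_def sector_def)+
    then have "norm (b x) < B + 1" "K * c0 * \<rho> \<le> K * c0 * norm x"
      using B(2)[of x] \<rho>(2)[of x] K c0_pos by (auto intro!: mult_left_mono)
    then show ?thesis using \<rho> c0_pos by (simp add: K_def)
  qed
  \<comment> \<open>With \<open>\<beta> = 0\<close> the direction is irrelevant; any unit vector will do.\<close>
  define \<tau> :: "real^2" where "\<tau> = axis 1 1"
  have t: "tilted_square 0 \<tau> x \<le> R\<^sup>2" if "x \<in> sector a c" for x
    using R[OF that] by (simp add: tilted_square_def dot_square_norm power_mono)
  have N0: "?N \<ge> 0" using section_max_nonneg[OF uc ac(1)] by simp
  have bound: "\<sigma> * u (polar r \<phi>) \<le> ?N" if \<sigma>: "\<sigma> = 1 \<or> \<sigma> = -1" and r: "r1 \<phi> \<le> r" "r \<le> r2 \<phi>" for \<sigma> r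
  proof (rule field_le_epsilon)
    fix e :: real assume e: "e > 0"
    define k where "k = e / exp (K * R\<^sup>2)"
    have k: "k > 0" using e by (simp add: k_def)
    have ke: "k * exp (K * tilted_square 0 \<tau> x) \<le> e" if "x \<in> sector a c" for x
    proof -
      have "k * exp (K * tilted_square 0 \<tau> x) \<le> k * exp (K * R\<^sup>2)"
        using t[OF that] K k by simp
      then show ?thesis by (simp add: k_def)
    qed
    have "\<sigma> * u (polar r \<phi>) + k * exp (K * tilted_square 0 \<tau> (polar r \<phi>)) \<le> ?N + e"
    proof (rule barrier_max_principle[OF u ac(1) order_trans[OF ac(2,3)] K Kb _ _ _ k _ _ ac(2,3) r])
      fix \<psi> s assume h: "a \<le> \<psi>" "\<psi> \<le> c" "s = r1 \<psi> \<or> s = r2 \<psi>"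
      then have "polar s \<psi> \<in> sector a c" using r1_less_r2[of \<psi>] ac by (force simp: sector_def)
      then show "k * exp (K * tilted_square 0 \<tau> (polar s \<psi>)) \<le> ?N + e"
        using ke N0 by fastforce
    next
      fix \<psi> s assume h: "\<psi> = a \<or> \<psi> = c" "r1 \<psi> \<le> s" "s \<le> r2 \<psi>"
      then have "polar s \<psi> \<in> sector a c" using ac by (force simp: sector_def)
      moreover have "\<bar>u (polar s \<psi>)\<bar> \<le> ?N"
        using h section_max_upper[OF uc, of \<psi> s] ac by auto
      then have "\<sigma> * u (polar s \<psi>) \<le> ?N" using \<sigma> by auto
      ultimately show "\<sigma> * u (polar s \<psi>) + k * exp (K * tilted_square 0 \<tau> (polar s \<psi>)) \<le> ?N + e"
        using ke by fastforce
    qed (auto simp: \<tau>_def)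
    moreover have "k * exp (K * tilted_square 0 \<tau> (polar r \<phi>)) \<ge> 0" using k by simp
    ultimately show "\<sigma> * u (polar r \<phi>) \<le> ?N + e" by linarith
  qed
  show ?thesis
    using bound[of 1] bound[of "-1"] ac by (intro section_max_least[OF uc]) (auto simp: abs_le_iff)
qed

text \<open>The heart of the matter. Across a half turn around the angle \<open>\<theta>\<close>, where \<open>\<bar>x\<bar>\<^sup>2\<close> oscillates by at
most \<open>D\<close>, compare \<open>u\<close> with \<open>N\<close>, the larger of the two end maxima, minus a barrier
\<open>N (exp (K (\<psi> - q - D)) - exp (- 2 K D))\<close>. At the end sections \<open>x\<close> is parallel to the tangent \<open>\<tau>\<close>
of the central section, so that \<open>\<psi> = (1 - \<beta>) \<bar>x\<bar>\<^sup>2\<close>, and \<open>\<beta>\<close> is chosen to give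
\<open>\<psi> \<le> q + D - 2 D\<close>: the subtracted barrier is nonpositive there. On the sides it is at most \<open>N\<close>, which
is harmless because \<open>u\<close> vanishes. At the central section \<open>\<psi> = \<bar>x\<bar>\<^sup>2 \<ge> q\<close>, and the barrier still has
the size \<open>N (exp (- K D) - exp (- 2 K D))\<close>, which is the asserted gain. A drift of size \<open>B\<close> needs \<open>K\<close>
proportional to \<open>B\<close>, so the gain is exponentially small in \<open>B D\<close>, with \<open>D\<close> as small as desired far
out on the spiral.\<close>

lemma section_max_contraction:
  assumes u: "solution u" and \<theta>: "\<theta>0 \<le> \<theta> - pi/2"
    and q: "0 < q" "0 < D" "3 * D \<le> q"
    and r: "\<And>\<phi>. \<theta> - pi/2 \<le> \<phi> \<Longrightarrow> \<phi> \<le> \<theta> + pi/2 \<Longrightarrow> q \<le> (r1 \<phi>)\<^sup>2 \<and> (r2 \<phi>)\<^sup>2 \<le> q + D"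
    and K: "K > 0"
    and b: "\<And>x. x \<in> spiral_strip r1 r2 {\<theta> - pi/2<..<\<theta> + pi/2} \<Longrightarrow> norm (b x) < K * c0 * sqrt q"
  shows "section_max r1 r2 u \<theta> \<le> (1 - exp (- (K * D)) * (1 - exp (- (K * D)))) *
     max (section_max r1 r2 u (\<theta> - pi/2)) (section_max r1 r2 u (\<theta> + pi/2))" (is "_ \<le> ?\<delta> * ?N")
proof -
  have uc: "continuous_on (spiral_closed \<theta>0 r1 r2) u" using u by (simp add: solution_def)
  have N0: "?N \<ge> 0" using section_max_nonneg[OF uc \<theta>] by simp
  have \<theta>': "\<theta>0 \<le> \<theta>" "\<theta> - pi/2 \<le> \<theta>" "\<theta> \<le> \<theta> + pi/2" "\<theta> - pi/2 \<le> \<theta> + pi/2"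
    using \<theta> pi_gt_zero by linarith+
  have rq: "q \<le> s\<^sup>2 \<and> s\<^sup>2 \<le> q + D \<and> 0 < s"
    if "\<theta> - pi/2 \<le> \<phi>" "\<phi> \<le> \<theta> + pi/2" "r1 \<phi> \<le> s" "s \<le> r2 \<phi>" for \<phi> s
  proof -
    have "0 < r1 \<phi>" using r1_pos[of \<phi>] that \<theta> by linarith
    then have "(r1 \<phi>)\<^sup>2 \<le> s\<^sup>2" "s\<^sup>2 \<le> (r2 \<phi>)\<^sup>2" "0 < s" using that by (auto intro: power_mono)
    then show ?thesis using r[of \<phi>] that by linarith
  qed
  have Kb: "norm (b x) < K * c0 * norm x" if x: "x \<in> spiral_strip r1 r2 {\<theta> - pi/2<..<\<theta> + pi/2}" for x
  proof -
    obtain s \<phi> where s: "x = polar s \<phi>" "\<theta> - pi/2 < \<phi>" "\<phi> < \<theta> + pi/2" "r1 \<phi> < s" "s < r2 \<phi>"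
      using x by (auto simp: spiral_strip_def)
    then have "sqrt q \<le> norm x" using rq[of \<phi> s] by (auto simp: norm_polar intro!: real_le_lsqrt)
    then have "K * c0 * sqrt q \<le> K * c0 * norm x" using K c0_pos by (intro mult_left_mono) auto
    then show ?thesis using b[OF x] by linarith
  qed
  show ?thesis
  proof (cases "?N = 0")
    case True
    then show ?thesis using section_max_quasiconvex[OF u \<theta> \<theta>'(2,3)] by simp
  next
    case False
    with N0 have N: "?N > 0" by simp
    define \<beta> where "\<beta> = 2 * D / (q + D)"
    define \<tau> where "\<tau> = polar 1 (\<theta> + pi/2)"
    \<comment> \<open>\<open>k exp (K \<psi>)\<close> equals the end maximum where \<open>\<psi>\<close> takes its largest possible value \<open>q + D\<close>.\<close>
    define k where "k = ?N * exp (- (K * (q + D)))"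
    have \<beta>: "0 \<le> \<beta>" "\<beta> \<le> 1/2" using q by (auto simp: \<beta>_def field_simps)
    have k: "k > 0" using N by (simp add: k_def)
    have kexp: "k * exp (K * t) = ?N * exp (K * (t - (q + D)))" for t
      by (simp add: k_def exp_add[symmetric] algebra_simps)
    have sq: "polar s \<phi> \<bullet> polar s \<phi> = s\<^sup>2" for s \<phi> by (simp add: inner_polar power2_eq_square)
    have at_ends: "tilted_square \<beta> \<tau> (polar s \<phi>) \<le> q + D - 2 * D"
      if "\<phi> = \<theta> - pi/2 \<or> \<phi> = \<theta> + pi/2" "s\<^sup>2 \<le> q + D" for s \<phi>
    proof -
      have "\<phi> - (\<theta> + pi/2) = - pi \<or> \<phi> - (\<theta> + pi/2) = 0" using that(1) by auto
      then have "(polar s \<phi> \<bullet> \<tau>)\<^sup>2 = s\<^sup>2" by (auto simp: \<tau>_def inner_polar)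
      then have "tilted_square \<beta> \<tau> (polar s \<phi>) = (1 - \<beta>) * s\<^sup>2"
        by (simp add: tilted_square_def sq algebra_simps)
      also have "\<dots> \<le> (1 - \<beta>) * (q + D)" using that(2) \<beta> by (intro mult_left_mono) auto
      also have "\<dots> = q + D - 2 * D" using q by (simp add: \<beta>_def field_simps)
      finally show ?thesis .
    qed
    have at_center: "tilted_square \<beta> \<tau> (polar s \<theta>) = s\<^sup>2" for s
      by (simp add: tilted_square_def sq \<tau>_def inner_polar)
    have bound: "\<sigma> * u (polar s \<theta>) \<le> ?\<delta> * ?N"
      if \<sigma>: "\<sigma> = 1 \<or> \<sigma> = -1" and s: "r1 \<theta> \<le> s" "s \<le> r2 \<theta>" for \<sigma> s
    proof -
      have "\<sigma> * u (polar s \<theta>) + k * exp (K * tilted_square \<beta> \<tau> (polar s \<theta>)) \<le> ?N + ?N * exp (- (2 * (K * D)))"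
      proof (rule barrier_max_principle[OF u \<theta> \<theta>'(4) K Kb _ \<beta> k _ _ \<theta>'(2,3) s])
        fix \<phi> s assume h: "\<theta> - pi/2 \<le> \<phi>" "\<phi> \<le> \<theta> + pi/2" "s = r1 \<phi> \<or> s = r2 \<phi>"
        then have "s\<^sup>2 \<le> q + D" using rq[of \<phi> s] r1_less_r2[of \<phi>] \<theta> by auto
        then have "tilted_square \<beta> \<tau> (polar s \<phi>) \<le> q + D"
          using mult_nonneg_nonneg[OF \<beta>(1), of "(polar s \<phi> \<bullet> \<tau>)\<^sup>2"] by (simp add: tilted_square_def sq)
        then have "k * exp (K * tilted_square \<beta> \<tau> (polar s \<phi>)) \<le> k * exp (K * (q + D))"
          using K k by simp
        also have "\<dots> = ?N" by (subst kexp) simp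
        finally show "k * exp (K * tilted_square \<beta> \<tau> (polar s \<phi>)) \<le> ?N + ?N * exp (- (2 * (K * D)))"
          using N by (simp add: add_increasing2)
      next
        fix \<phi> s assume h: "\<phi> = \<theta> - pi/2 \<or> \<phi> = \<theta> + pi/2" "r1 \<phi> \<le> s" "s \<le> r2 \<phi>"
        have "tilted_square \<beta> \<tau> (polar s \<phi>) \<le> q + D - 2 * D"
          using at_ends[OF h(1), of s] rq[of \<phi> s] h by auto
        then have "k * exp (K * tilted_square \<beta> \<tau> (polar s \<phi>)) \<le> k * exp (K * (q + D - 2 * D))"
          using K k by simp
        also have "\<dots> = ?N * exp (- (2 * (K * D)))" by (subst kexp) (simp add: algebra_simps)
        moreover have "\<bar>u (polar s \<phi>)\<bar> \<le> ?N"
          using h section_max_upper[OF uc, of \<phi> s] \<theta> order_trans[OF \<theta> \<theta>'(4)] by auto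
        then have "\<sigma> * u (polar s \<phi>) \<le> ?N" using \<sigma> by auto
        ultimately show "\<sigma> * u (polar s \<phi>) + k * exp (K * tilted_square \<beta> \<tau> (polar s \<phi>))
            \<le> ?N + ?N * exp (- (2 * (K * D)))" by linarith
      qed (simp_all add: \<tau>_def norm_polar)
      moreover have "?N * exp (- (K * D)) \<le> k * exp (K * s\<^sup>2)"
      proof -
        have "K * - D \<le> K * (s\<^sup>2 - (q + D))" using rq[of \<theta> s] s K \<theta>' by (intro mult_left_mono) auto
        then show ?thesis unfolding kexp using N by simp
      qed
      ultimately have "\<sigma> * u (polar s \<theta>) \<le> ?N + ?N * exp (- (2 * (K * D))) - ?N * exp (- (K * D))"
        unfolding at_center by linarith
      also have "exp (- (2 * (K * D))) = exp (- (K * D)) * exp (- (K * D))"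
        by (simp add: exp_add[symmetric])
      finally show ?thesis by (simp add: algebra_simps)
    qed
    show ?thesis
      using bound[of 1] bound[of "-1"] by (intro section_max_least[OF uc \<theta>'(1)]) (auto simp: abs_le_iff)
  qed
qed

end

section \<open>Iterating a contraction with a decreasing rate\<close>

lemma real_step_induct:
  fixes a h :: real
  assumes h: "h > 0"
    and base: "\<And>t. a \<le> t \<Longrightarrow> t \<le> a + h \<Longrightarrow> P t"
    and step: "\<And>t. a + h \<le> t \<Longrightarrow> P (t - h) \<Longrightarrow> P t"
    and t: "a \<le> t"
  shows "P t"
proof -
  have main: "a \<le> t \<Longrightarrow> t \<le> a + (real n + 1) * h \<Longrightarrow> P t" for n t
  proof (induction n arbitrary: t)
    case 0
    then show ?case using base by simp
  next
    case (Suc n)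
    show ?case
    proof (cases "t \<le> a + h")
      case False
      show ?thesis by (rule step) (use False Suc.IH[of "t - h"] Suc.prems in \<open>auto simp: algebra_simps\<close>)
    qed (use Suc.prems base in auto)
  qed
  obtain n where "(t - a) / h < real n" using reals_Archimedean2 by blast
  then have "t \<le> a + (real n + 1) * h" using h by (simp add: field_simps)
  then show ?thesis using main t by blast
qed

text \<open>The rate \<open>g\<close> stands for \<open>\<kappa> powr m\<close>. Since \<open>g\<close> is merely monotone, all comparisons between
its values and its integral use monotonicity over one step.\<close>

locale decreasing_rate =
  fixes g :: "real \<Rightarrow> real" and T :: real
  assumes antimono: "\<And>s t. T \<le> s \<Longrightarrow> s \<le> t \<Longrightarrow> g t \<le> g s"
    and nonneg: "\<And>t. T \<le> t \<Longrightarrow> 0 \<le> g t"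
begin

lemma integrable: assumes "T \<le> s" shows "g integrable_on {s..t}"
proof -
  have "mono_on {s..t} (\<lambda>x. - g x)"
    using assms by (auto intro!: mono_onI antimono)
  from integrable_neg[OF integrable_on_mono_on[OF this]] show ?thesis by simp
qed

lemma integral_bounds:
  assumes "T \<le> s" "s \<le> t"
  shows "0 \<le> integral {s..t} g" "integral {s..t} g \<le> (t - s) * g s"
proof -
  show "0 \<le> integral {s..t} g"
    using assms by (intro integral_nonneg integrable) (auto intro: nonneg)
  have "integral {s..t} g \<le> integral {s..t} (\<lambda>_. g s)"
    using assms by (intro integral_le integrable) (auto intro: antimono)
  then show "integral {s..t} g \<le> (t - s) * g s" using assms by simp
qed

text \<open>The lower limit \<open>a\<close> may exceed \<open>t\<close> or even \<open>t + h\<close>, in which case integrals over empty intervals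
are zero. This lets the decay estimate start its integral later than its iteration.\<close>

lemma integral_shift_bounds:
  assumes "T \<le> a" "T \<le> t" "0 \<le> h"
  shows "integral {a..t} g \<le> integral {a..t + h} g" "integral {a..t + h} g \<le> integral {a..t} g + h * g t"
proof -
  have "integral {a..t} g \<le> integral {a..t + h} g \<and> integral {a..t + h} g \<le> integral {a..t} g + h * g t"
  proof (cases "a \<le> t")
    case True
    have "integral {a..t} g + integral {t..t + h} g = integral {a..t + h} g"
      using True assms by (intro Henstock_Kurzweil_Integration.integral_combine integrable) auto
    then show ?thesis using integral_bounds[of t "t + h"] assms by simp
  next
    case False
    then have z: "integral {a..t} g = 0" by simp
    show ?thesis
    proof (cases "a \<le> t + h")
      case True
      have "(t + h - a) * g a \<le> h * g t"
        using False True assms by (intro mult_mono antimono nonneg) auto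
      then show ?thesis using z integral_bounds[of a "t + h"] True assms by simp
    next
      case False
      then show ?thesis using z assms nonneg[of t] by simp
    qed
  qed
  then show "integral {a..t} g \<le> integral {a..t + h} g" "integral {a..t + h} g \<le> integral {a..t} g + h * g t" by auto
qed

text \<open>If the integrals stayed bounded, monotone convergence along the intervals \<open>{T..T + n}\<close> would bound
the integral over the half-line. Only the values on \<open>{T..}\<close> are controlled, so \<open>g\<close> is first
continued to the left by a constant, which makes it monotone and hence Borel on the whole line.\<close>

lemma integral_at_top:
  assumes inf: "(\<integral>\<^sup>+ t\<in>{T..}. ennreal (g t) \<partial>lborel) = \<infinity>" and a: "T \<le> a"
  shows "filterlim (\<lambda>t. integral {a..t} g) at_top at_top"
proof -
  define G where "G t = g (max t T)" for t
  have Gm: "G \<in> borel_measurable borel"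
  proof -
    have "mono (\<lambda>t. - G t)" by (auto intro!: monoI antimono simp: G_def)
    then have "(\<lambda>t. - G t) \<in> borel_measurable borel" by (rule borel_measurable_mono)
    then show ?thesis by (rule borel_measurable_uminus_eq[THEN iffD1])
  qed
  have G0: "0 \<le> G t" for t by (simp add: G_def nonneg)
  have unb: "\<exists>n::nat. C < integral {T..T + real n} g" for C
  proof (rule ccontr)
    assume "\<not> ?thesis"
    then have C: "integral {T..T + real n} g \<le> C" for n :: nat by (auto simp: not_less)
    let ?\<mu> = "density lborel (\<lambda>t. ennreal (G t))"
    have mu: "emeasure ?\<mu> {T..T + real n} \<le> ennreal C" for n :: nat
    proof -
      have "(g has_integral integral {T..T + real n} g) {T..T + real n}"
        using integrable[of T] by (simp add: has_integral_integral)
      then have "((\<lambda>t. if t \<in> {T..T + real n} then g t else 0) has_integral integral {T..T + real n} g) UNIV"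
        by (simp only: has_integral_restrict_UNIV)
      also have "(\<lambda>t. if t \<in> {T..T + real n} then g t else 0) = (\<lambda>t. G t * indicator {T..T + real n} t)"
        by (auto simp: G_def max_def indicator_def)
      finally have "(\<integral>\<^sup>+ t. ennreal (G t * indicator {T..T + real n} t) \<partial>lborel) = ennreal (integral {T..T + real n} g)"
        using Gm G0 by (intro nn_integral_has_integral_lborel) auto
      then have "emeasure ?\<mu> {T..T + real n} = ennreal (integral {T..T + real n} g)"
        using Gm G0 by (simp add: emeasure_density ennreal_mult' ennreal_indicator)
      then show ?thesis using C[of n] by (simp add: ennreal_leI)
    qed
    have "(\<Union>n::nat. {T..T + real n}) = {T..}"
    proof -
      have "\<exists>n::nat. t \<le> T + real n" for t using real_arch_simple[of "t - T"] by (auto simp: algebra_simps)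
      then show ?thesis by auto
    qed
    then have "emeasure ?\<mu> {T..} = (SUP n::nat. emeasure ?\<mu> {T..T + real n})"
      by (subst SUP_emeasure_incseq) (auto simp: incseq_def)
    also have "\<dots> \<le> ennreal C" by (rule SUP_least) (rule mu)
    finally have "emeasure ?\<mu> {T..} < \<infinity>" by (simp add: le_less_trans less_top)
    moreover have "emeasure ?\<mu> {T..} = (\<integral>\<^sup>+ t\<in>{T..}. ennreal (g t) \<partial>lborel)"
    proof -
      have "emeasure ?\<mu> {T..} = (\<integral>\<^sup>+ t\<in>{T..}. ennreal (G t) \<partial>lborel)"
        using Gm by (simp add: emeasure_density)
      then show ?thesis by (auto intro!: nn_integral_cong simp: G_def max_def indicator_def)
    qed
    ultimately show False using inf by simp
  qed
  show ?thesis unfolding filterlim_at_top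
  proof
    fix Z :: real
    obtain n :: nat where n: "Z + integral {T..a} g < integral {T..T + real n} g" using unb by blast
    have "Z \<le> integral {a..t} g" if t: "t \<ge> max a (T + real n)" for t
    proof -
      have "integral {T..T + real n} g \<le> integral {T..t} g"
        using integral_shift_bounds(1)[of T "T + real n" "t - (T + real n)"] t by simp
      moreover have "integral {T..a} g + integral {a..t} g = integral {T..t} g"
        using a t by (intro Henstock_Kurzweil_Integration.integral_combine integrable) auto
      ultimately show ?thesis using n by simp
    qed
    then show "\<forall>\<^sub>F t in at_top. Z \<le> integral {a..t} g"
      unfolding eventually_at_top_linorder by blast
  qed
qed

text \<open>A quasiconvex \<open>M\<close> is either nonincreasing, or it exceeds an earlier value at some \<open>c\<close> and is then
nondecreasing from \<open>c\<close> on. In the first case the larger neighbour in the contraction inequality is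
\<open>M (t - h)\<close>, so each step of length \<open>h\<close> multiplies \<open>M\<close> by at most \<open>exp (- \<delta> g (t + h))\<close>; in the
second case the larger neighbour is \<open>M (t + h)\<close>, and each step multiplies \<open>M\<close> by at least the
reciprocal. As \<open>g\<close> decreases, \<open>h g\<close> at the left end of a step bounds the integral over the step,
which turns the products into exponentials of \<open>\<delta> / h\<close> times the integral of \<open>g\<close>.

The step from \<open>t - h\<close> to \<open>t\<close> gains \<open>g (t + h)\<close>, that is, the integral over \<open>{t + h..t + 2 h}\<close>.
Hence the induction carries an integral that is ahead by \<open>2 h\<close>. It starts on \<open>{S..S + h}\<close>, and the
lower limit \<open>S + 3 h\<close> makes that integral vanish there. In the growth case the corresponding lead is
\<open>h\<close>, and the initial discrepancy goes into the constant \<open>C\<close>.\<close>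

lemma quasiconvex_dichotomy:
  fixes M :: "real \<Rightarrow> real"
  assumes M0: "\<And>t. \<theta>0 \<le> t \<Longrightarrow> 0 \<le> M t"
    and quasi: "\<And>a t c. \<theta>0 \<le> a \<Longrightarrow> a \<le> t \<Longrightarrow> t \<le> c \<Longrightarrow> M t \<le> max (M a) (M c)"
    and TS: "\<theta>0 \<le> T" "T \<le> S" and h: "h > 0" and \<delta>: "\<delta> > 0"
    and contraction: "\<And>t. S + h \<le> t \<Longrightarrow> M t \<le> (1 - \<delta> * g (t + h)) * max (M (t - h)) (M (t + h))"
    and inf: "(\<integral>\<^sup>+ t\<in>{T..}. ennreal (g t) \<partial>lborel) = \<infinity>"
  shows "((\<forall>t\<ge>\<theta>0. M t \<le> M \<theta>0 * (if t < S + 3 * h then 1 else min 1 (exp (- (\<delta> / h) * integral {S + 3 * h..t} g)))) \<and>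
           (M \<longlongrightarrow> 0) at_top)
       \<or> ((\<exists>C>0. \<forall>\<^sub>F t in at_top. C * exp (\<delta> / h * integral {T..t} g) \<le> M t) \<and> filterlim M at_top at_top)"
proof -
  define \<nu> where "\<nu> = \<delta> / h"
  have \<nu>: "\<nu> > 0" "\<nu> * (h * z) = \<delta> * z" for z using \<delta> h by (auto simp: \<nu>_def)
  have contr: "M t \<le> exp (- (\<delta> * g (t + h))) * max (M (t - h)) (M (t + h))" if "S + h \<le> t" for t
  proof -
    have "1 - \<delta> * g (t + h) \<le> exp (- (\<delta> * g (t + h)))" using exp_ge_add_one_self[of "- (\<delta> * g (t + h))"] by simp
    moreover have "0 \<le> max (M (t - h)) (M (t + h))" using M0[of "t + h"] that TS h by simp
    ultimately show ?thesis by (rule order_trans[OF contraction[OF that] mult_right_mono])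
  qed
  show ?thesis
  proof (cases "\<forall>a c. \<theta>0 \<le> a \<longrightarrow> a \<le> c \<longrightarrow> M c \<le> M a")
    case True
    then have dec: "M c \<le> M a" if "\<theta>0 \<le> a" "a \<le> c" for a c using that by blast
    define J where "J t = integral {S + 3 * h..t} g" for t
    have ahead: "M t \<le> M \<theta>0 * exp (- \<nu> * J (t + 2 * h))" if "S \<le> t" for t
    proof (rule real_step_induct[OF h _ _ that, where P = "\<lambda>t. M t \<le> M \<theta>0 * exp (- \<nu> * J (t + 2 * h))"])
      fix t assume t: "S \<le> t" "t \<le> S + h"
      have "integral {s..r} g = 0" if "r \<le> s" for r s using that by (cases "r = s") auto
      moreover have "t + 2 * h \<le> S + 3 * h" using t by simp
      ultimately have "J (t + 2 * h) = 0" unfolding J_def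
        by blast
      then show "M t \<le> M \<theta>0 * exp (- \<nu> * J (t + 2 * h))" using dec t TS by simp
    next
      fix t assume t: "S + h \<le> t" and IH: "M (t - h) \<le> M \<theta>0 * exp (- \<nu> * J (t - h + 2 * h))"
      have "J (t + 2 * h) \<le> J (t + h) + h * g (t + h)"
        using integral_shift_bounds(2)[of "S + 3 * h" "t + h" h] t TS h by (simp add: J_def algebra_simps)
      then have "\<nu> * J (t + 2 * h) \<le> \<nu> * (J (t + h) + h * g (t + h))" using \<nu> by (intro mult_left_mono) auto
      then have J: "\<nu> * J (t + 2 * h) \<le> \<nu> * J (t + h) + \<delta> * g (t + h)" by (simp only: distrib_left \<nu>(2))
      have "max (M (t - h)) (M (t + h)) = M (t - h)" using dec[of "t - h" "t + h"] t TS h by simp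
      then have "M t \<le> exp (- (\<delta> * g (t + h))) * M (t - h)" using contr[OF t] by simp
      also have "\<dots> \<le> exp (- (\<delta> * g (t + h))) * (M \<theta>0 * exp (- \<nu> * J (t + h)))"
        using IH by (intro mult_left_mono) (auto simp: algebra_simps)
      also have "\<dots> = M \<theta>0 * exp (- (\<nu> * J (t + h) + \<delta> * g (t + h)))"
        by (simp add: mult_exp_exp mult.left_commute add.commute)
      also have "\<dots> \<le> M \<theta>0 * exp (- \<nu> * J (t + 2 * h))"
        using J M0[of \<theta>0] by (intro mult_left_mono) auto
      finally show "M t \<le> M \<theta>0 * exp (- \<nu> * J (t + 2 * h))" .
    qed
    have decay: "M t \<le> M \<theta>0 * exp (- \<nu> * J t)" if "S \<le> t" for t
    proof -
      have "J t \<le> J (t + 2 * h)"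
        using integral_shift_bounds(1)[of "S + 3 * h" t "2 * h"] that TS h by (simp add: J_def)
      then have "M \<theta>0 * exp (- \<nu> * J (t + 2 * h)) \<le> M \<theta>0 * exp (- \<nu> * J t)"
        using \<nu>(1) M0[of \<theta>0] by (intro mult_left_mono) auto
      with ahead[OF that] show ?thesis by (rule order_trans)
    qed
    have "M t \<le> M \<theta>0 * (if t < S + 3 * h then 1 else min 1 (exp (- \<nu> * J t)))" if "\<theta>0 \<le> t" for t
      using dec[of \<theta>0 t] decay[of t] that h by (auto simp: min_def)
    moreover have "(M \<longlongrightarrow> 0) at_top"
    proof (rule tendsto_sandwich)
      show "\<forall>\<^sub>F t in at_top. 0 \<le> M t" using M0 by (auto simp: eventually_at_top_linorder)
      show "\<forall>\<^sub>F t in at_top. M t \<le> M \<theta>0 * exp (- \<nu> * J t)" using decay by (auto simp: eventually_at_top_linorder)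
      have "filterlim J at_top at_top" unfolding J_def by (rule integral_at_top[OF inf]) (use TS h in auto)
      then have "filterlim (\<lambda>t. - (\<nu> * J t)) at_bot at_top"
        unfolding filterlim_uminus_at_top[symmetric]
        by (intro filterlim_tendsto_pos_mult_at_top[OF tendsto_const \<nu>(1)])
      then have "((\<lambda>t. exp (- (\<nu> * J t))) \<longlongrightarrow> 0) at_top"
        by (rule filterlim_compose[OF exp_at_bot])
      then show "((\<lambda>t. M \<theta>0 * exp (- \<nu> * J t)) \<longlongrightarrow> 0) at_top" using tendsto_mult_right_zero[of "\<lambda>t. exp (- (\<nu> * J t))"] by simp
    qed auto
    ultimately show ?thesis unfolding J_def \<nu>_def by blast
  next
    case False
    then obtain a c where ac: "\<theta>0 \<le> a" "a \<le> c" "M a < M c" by (auto simp: not_le)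
    have above: "M a < M s" if "c \<le> s" for s
      using quasi[of a c s] ac that by auto
    have inc: "M s \<le> M t" if "c \<le> s" "s \<le> t" for s t
      using quasi[of a s t] above[of s] ac that by auto
    define R where "R = max c S + h"
    have R: "c + h \<le> R" "S + h \<le> R" "c \<le> R" using h by (auto simp: R_def)
    define J where "J t = integral {T..t} g" for t
    define C where "C = M R * exp (- \<nu> * J (R + 2 * h))"
    have "M R > 0" using above[OF R(3)] M0[of a] ac by linarith
    then have C: "C > 0" by (simp add: C_def)
    have growth: "C * exp (\<nu> * J (t + h)) \<le> M t" if "R \<le> t" for t
    proof (rule real_step_induct[OF h _ _ that, where P = "\<lambda>t. C * exp (\<nu> * J (t + h)) \<le> M t"])
      fix t assume t: "R \<le> t" "t \<le> R + h"
      have "J (t + h) \<le> J (R + 2 * h)"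
        using integral_shift_bounds(1)[of T "t + h" "R + h - t"] t R TS h by (simp add: J_def algebra_simps)
      then have "exp (\<nu> * J (t + h)) \<le> exp (\<nu> * J (R + 2 * h))" using \<nu>(1) by simp
      then have "C * exp (\<nu> * J (t + h)) \<le> C * exp (\<nu> * J (R + 2 * h))" using C by (intro mult_left_mono) auto
      also have "\<dots> = M R" by (simp add: C_def exp_minus field_simps)
      also have "\<dots> \<le> M t" using inc R t by auto
      finally show "C * exp (\<nu> * J (t + h)) \<le> M t" .
    next
      fix t assume t: "R + h \<le> t" and IH: "C * exp (\<nu> * J (t - h + h)) \<le> M (t - h)"
      have "J (t + h) \<le> J t + h * g t"
        using integral_shift_bounds(2)[of T t h] t R TS h by (simp add: J_def)
      then have "\<nu> * J (t + h) \<le> \<nu> * (J t + h * g t)" using \<nu>(1) by (intro mult_left_mono) auto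
      then have J: "\<nu> * J (t + h) \<le> \<nu> * J t + \<delta> * g t" by (simp only: distrib_left \<nu>(2))
      have "max (M (t - h - h)) (M (t - h + h)) = M t" using inc[of "t - h - h" t] t R h by simp
      then have less: "M (t - h) \<le> exp (- (\<delta> * g t)) * M t" using contr[of "t - h"] t R by simp
      have "C * exp (\<nu> * J (t + h)) \<le> C * exp (\<nu> * J t + \<delta> * g t)" using J C by simp
      also have "\<dots> = exp (\<delta> * g t) * (C * exp (\<nu> * J (t - h + h)))" by (simp add: exp_add)
      also have "\<dots> \<le> exp (\<delta> * g t) * M (t - h)" using IH by (intro mult_left_mono) auto
      also have "\<dots> \<le> exp (\<delta> * g t) * (exp (- (\<delta> * g t)) * M t)"
        using less by (intro mult_left_mono) auto
      also have "\<dots> = M t" by (simp add: exp_minus)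
      finally show "C * exp (\<nu> * J (t + h)) \<le> M t" .
    qed
    have growth': "C * exp (\<nu> * J t) \<le> M t" if "R \<le> t" for t
    proof -
      have "J t \<le> J (t + h)" using integral_shift_bounds(1)[of T t h] that R TS h by (simp add: J_def)
      then have "C * exp (\<nu> * J t) \<le> C * exp (\<nu> * J (t + h))" using \<nu>(1) C by simp
      then show ?thesis using growth[OF that] by linarith
    qed
    have "filterlim J at_top at_top" unfolding J_def by (rule integral_at_top[OF inf]) simp
    then have "filterlim (\<lambda>t. C * exp (\<nu> * J t)) at_top at_top"
      by (intro filterlim_tendsto_pos_mult_at_top[OF tendsto_const] C \<nu>(1) filterlim_compose[OF exp_at_top])
    then have "filterlim M at_top at_top"
      by (rule filterlim_at_top_mono) (use growth' in \<open>auto simp: eventually_at_top_linorder\<close>)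
    moreover have "\<forall>\<^sub>F t in at_top. C * exp (\<nu> * J t) \<le> M t"
      using growth' by (auto simp: eventually_at_top_linorder)
    ultimately show ?thesis using C unfolding J_def \<nu>_def by blast
  qed
qed

end

section \<open>The dichotomy for solutions on the spiral\<close>

theorem theorem4p10:
  fixes \<theta>0 r_star c0 M1 \<Theta>bar \<kappa> :: real
    and r1 r2 m :: "real \<Rightarrow> real"
    and A :: "real^2 \<Rightarrow> real^2^2"
    and b :: "real^2 \<Rightarrow> real^2"
  defines "U \<equiv> spiral_domain \<theta>0 r1 r2"
  assumes r_cont: "continuous_on {\<theta>0..} r1" "continuous_on {\<theta>0..} r2"
    and r_pos: "\<forall>\<theta>\<ge>\<theta>0. 0 < r1 \<theta> \<and> 0 < r2 \<theta>"
    and r_order: "\<forall>\<theta>\<ge>\<theta>0. r2 (\<theta> + 2 * pi) < r1 \<theta> \<and> r1 \<theta> < r2 \<theta>"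
    and r_lim: "r_star > 0" "(r1 \<longlongrightarrow> r_star) at_top" "(r2 \<longlongrightarrow> r_star) at_top"
    and A_sym: "\<forall>x\<in>U. transpose (A x) = A x"
    and ellipticity: "c0 > 0" "M1 > 0"
      "\<forall>x\<in>U. \<forall>\<xi>. \<xi> \<bullet> (A x *v \<xi>) \<ge> c0 * (norm \<xi>)\<^sup>2"
      "\<forall>x\<in>U. trace (A x) \<le> M1"
    and drift: "\<Theta>bar \<ge> \<theta>0" "mono_on {\<Theta>bar..} m" "\<forall>\<theta>\<ge>\<Theta>bar. 0 \<le> m \<theta>"
      "bounded (b ` (U \<inter> spiral_strip r1 r2 {\<theta>0..\<Theta>bar}))"
      "\<forall>\<theta>\<ge>\<Theta>bar. \<forall>x \<in> U \<inter> cross_section r1 r2 \<theta>. norm (b x) \<le> m \<theta>"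
      "filterlim m at_top at_top"
      "0 < \<kappa>" "\<kappa> < 1"
      "(\<integral>\<^sup>+ \<theta>\<in>{\<Theta>bar..}. ennreal (\<kappa> powr m \<theta>) \<partial>lborel) = \<infinity>"
  shows "\<exists>\<Theta>0 \<nu>. \<Theta>0 \<ge> \<Theta>bar \<and> \<nu> > 0 \<and>
    (\<forall>u. C2_on U u \<and> continuous_on (spiral_closed \<theta>0 r1 r2) u \<and>
         (\<forall>x\<in>U. drift_operator A b u x = 0) \<and> (\<forall>x\<in>spiral_sides \<theta>0 r1 r2. u x = 0) \<longrightarrow>
      ((\<forall>\<theta>\<ge>\<theta>0. section_max r1 r2 u \<theta> \<le> section_max r1 r2 u \<theta>0 *
            (if \<theta> < \<Theta>0 then 1
             else min 1 (exp (- \<nu> * integral {\<Theta>0..\<theta>} (\<lambda>\<zeta>. \<kappa> powr m \<zeta>))))) \<and>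
        (section_max r1 r2 u \<longlongrightarrow> 0) at_top)
      \<or>
      ((\<exists>C>0. \<forall>\<^sub>F \<theta> in at_top. section_max r1 r2 u \<theta> \<ge>
            C * exp (\<nu> * integral {\<Theta>bar..\<theta>} (\<lambda>\<zeta>. \<kappa> powr m \<zeta>))) \<and>
        filterlim (section_max r1 r2 u) at_top at_top))"
proof -
  have m_mono: "m s \<le> m t" if "\<Theta>bar \<le> s" "s \<le> t" for s t
    using drift(2) that by (auto simp: mono_on_def)
  have b_strip: "norm (b x) \<le> m t"
    if "x = polar r \<phi>" "\<Theta>bar \<le> \<phi>" "\<theta>0 < \<phi>" "\<phi> \<le> t" "r1 \<phi> < r" "r < r2 \<phi>" for x r \<phi> t
  proof -
    have "x \<in> U \<inter> cross_section r1 r2 \<phi>"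
      using that by (force simp: U_def spiral_domain_def spiral_strip_def cross_section_def)
    then have "norm (b x) \<le> m \<phi>" using drift(5) that(2) by blast
    then show ?thesis using m_mono[OF that(2,4)] by linarith
  qed
  interpret spiral_equation \<theta>0 r1 r2 A b c0
  proof unfold_locales
    fix T
    obtain B0 where B0: "\<And>x. x \<in> U \<inter> spiral_strip r1 r2 {\<theta>0..\<Theta>bar} \<Longrightarrow> norm (b x) \<le> B0"
      using drift(4) by (auto simp: bounded_iff)
    define B where "B = max B0 (m (max T \<Theta>bar))"
    have "norm (b x) \<le> B" if xS: "x \<in> spiral_strip r1 r2 {\<theta>0<..<T}" for x
    proof -
      obtain r \<phi> where x: "x = polar r \<phi>" "\<theta>0 < \<phi>" "\<phi> < T" "r1 \<phi> < r" "r < r2 \<phi>"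
        using xS by (auto simp: spiral_strip_def)
      show ?thesis
      proof (cases "\<phi> \<le> \<Theta>bar")
        case True
        then have "x \<in> U \<inter> spiral_strip r1 r2 {\<theta>0..\<Theta>bar}"
          using x by (force simp: U_def spiral_domain_def spiral_strip_def)
        then show ?thesis using B0 by (force simp: B_def)
      next
        case False
        then show ?thesis using b_strip[of x r \<phi> "max T \<Theta>bar"] x by (auto simp: B_def)
      qed
    qed
    moreover have "B \<ge> 0" using drift(3) by (simp add: B_def le_max_iff_disj)
    ultimately show "\<exists>B\<ge>0. \<forall>x\<in>spiral_strip r1 r2 {\<theta>0<..<T}. norm (b x) \<le> B" by blast
  qed (use assms in auto)
  interpret rate: decreasing_rate "\<lambda>t. \<kappa> powr m t" \<Theta>bar
    by unfold_locales (use m_mono drift in \<open>auto intro: powr_mono'\<close>)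
  define Q where "Q = r_star\<^sup>2"
  have Q: "Q > 0" using r_lim by (simp add: Q_def)
  \<comment> \<open>\<open>D\<close> bounds the oscillation of \<open>\<bar>x\<bar>\<^sup>2\<close> far out. Its first bound keeps \<open>\<bar>x\<bar> \<ge> r_star / 2\<close> and the
    tilt at most \<open>1/2\<close>; the second makes the exponential loss across the strip at most one factor
    \<open>\<kappa>\<close> per unit of \<open>m + 1\<close>.\<close>
  define D where "D = min (Q / 8) (- ln \<kappa> * (c0 * r_star) / 2)"
  have ln\<kappa>: "ln \<kappa> < 0" using drift by simp
  have D: "D > 0" "D \<le> Q / 8" "D \<le> - ln \<kappa> * (c0 * r_star) / 2"
    using Q ln\<kappa> ellipticity(1) r_lim(1) by (auto simp: D_def mult_neg_pos)
  define \<eta> where "\<eta> = 2 * D / (c0 * r_star)"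
  have cr: "c0 * r_star > 0" using ellipticity(1) r_lim(1) by simp
  have \<eta>: "\<eta> > 0" "\<eta> \<le> - ln \<kappa>" using D cr by (auto simp: \<eta>_def pos_divide_le_eq)
  define \<delta> where "\<delta> = \<kappa> * (1 - exp (- \<eta>))"
  have \<delta>: "\<delta> > 0" using \<eta> drift by (simp add: \<delta>_def)
  have near: "\<forall>\<^sub>F \<theta> in at_top. Q - D/2 \<le> (r \<theta>)\<^sup>2 \<and> (r \<theta>)\<^sup>2 \<le> Q + D/2" if "(r \<longlongrightarrow> r_star) at_top" for r
  proof -
    have "((\<lambda>\<theta>. (r \<theta>)\<^sup>2) \<longlongrightarrow> Q) at_top" unfolding Q_def using that by (rule tendsto_power)
    then have "\<forall>\<^sub>F \<theta> in at_top. dist ((r \<theta>)\<^sup>2) Q < D/2" by (rule tendstoD) (use D in simp)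
    then show ?thesis by eventually_elim (unfold dist_real_def, arith)
  qed
  obtain S0 where S0: "\<And>\<theta>. S0 \<le> \<theta> \<Longrightarrow> Q - D/2 \<le> (r1 \<theta>)\<^sup>2 \<and> (r2 \<theta>)\<^sup>2 \<le> Q + D/2"
    using eventually_conj[OF near[OF r_lim(2)] near[OF r_lim(3)]] unfolding eventually_at_top_linorder by blast
  define S where "S = max \<Theta>bar S0"
  have S: "\<Theta>bar \<le> S" "S0 \<le> S" by (auto simp: S_def)
  have contraction: "section_max r1 r2 u \<theta> \<le> (1 - \<delta> * \<kappa> powr m (\<theta> + pi/2)) *
       max (section_max r1 r2 u (\<theta> - pi/2)) (section_max r1 r2 u (\<theta> + pi/2))"
    if u: "solution u" and \<theta>: "S + pi/2 \<le> \<theta>" for u \<theta>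
  proof -
    define q where "q = Q - D/2"
    define \<mu> where "\<mu> = m (\<theta> + pi/2)"
    \<comment> \<open>The factor \<open>2 / r_star\<close> accounts for \<open>\<bar>x\<bar> \<ge> r_star / 2\<close>. The summand \<open>1\<close> gives the strict
      inequality and keeps \<open>K D \<ge> \<eta>\<close>, so that \<open>1 - exp (- K D)\<close> is bounded below.\<close>
    define K where "K = 2 * (\<mu> + 1) / (c0 * r_star)"
    have \<theta>': "S \<le> \<theta> - pi/2" "\<Theta>bar \<le> \<theta> + pi/2" using \<theta> S pi_gt_zero by linarith+
    have \<mu>: "\<mu> \<ge> 0" using drift(3) \<theta>' by (simp add: \<mu>_def)
    have K: "K > 0" using \<mu> cr by (simp add: K_def)
    have KD: "K * D = (\<mu> + 1) * \<eta>" by (simp add: K_def \<eta>_def)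
    have "(r_star / 2)\<^sup>2 \<le> q" using D by (simp add: q_def Q_def power_divide)
    then have sq: "r_star / 2 \<le> sqrt q" by (rule real_le_rsqrt)
    have bK: "norm (b x) < K * c0 * sqrt q"
      if xS: "x \<in> spiral_strip r1 r2 {\<theta> - pi/2<..<\<theta> + pi/2}" for x
    proof -
      obtain r \<phi> where x: "x = polar r \<phi>" "\<theta> - pi/2 < \<phi>" "\<phi> < \<theta> + pi/2" "r1 \<phi> < r" "r < r2 \<phi>"
        using xS by (auto simp: spiral_strip_def)
      have "norm (b x) \<le> \<mu>"
        unfolding \<mu>_def by (rule b_strip[of x r \<phi>]) (use x \<theta>' S drift(1) in auto)
      moreover have "\<mu> + 1 = K * c0 * (r_star / 2)" using ellipticity(1) r_lim(1) by (simp add: K_def)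
      moreover have "K * c0 * (r_star / 2) \<le> K * c0 * sqrt q"
        using sq K ellipticity(1) by (intro mult_left_mono) auto
      ultimately show ?thesis by linarith
    qed
    have "section_max r1 r2 u \<theta> \<le> (1 - exp (- (K * D)) * (1 - exp (- (K * D)))) *
       max (section_max r1 r2 u (\<theta> - pi/2)) (section_max r1 r2 u (\<theta> + pi/2))"
    proof (rule section_max_contraction[OF u, where q = q])
      fix \<phi> assume "\<theta> - pi/2 \<le> \<phi>"
      then show "q \<le> (r1 \<phi>)\<^sup>2 \<and> (r2 \<phi>)\<^sup>2 \<le> q + D" using S0[of \<phi>] \<theta>' S by (simp add: q_def)
    qed (use \<theta>' S drift(1) D Q K bK in \<open>auto simp: q_def\<close>)
    also have "\<dots> \<le> (1 - \<delta> * \<kappa> powr \<mu>) *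
       max (section_max r1 r2 u (\<theta> - pi/2)) (section_max r1 r2 u (\<theta> + pi/2))"
    proof (rule mult_right_mono)
      have "(\<mu> + 1) * \<eta> \<le> (\<mu> + 1) * - ln \<kappa>" using \<mu> \<eta> by (intro mult_left_mono) auto
      then have "exp ((\<mu> + 1) * ln \<kappa>) \<le> exp (- (K * D))" unfolding KD by simp
      then have 1: "\<kappa> powr \<mu> * \<kappa> \<le> exp (- (K * D))"
        using drift(7) by (simp add: powr_def exp_add algebra_simps)
      have "1 * \<eta> \<le> (\<mu> + 1) * \<eta>" using \<mu> \<eta> by (intro mult_right_mono) auto
      then have 2: "1 - exp (- \<eta>) \<le> 1 - exp (- (K * D))" unfolding KD by simp
      have "\<kappa> powr \<mu> * \<kappa> * (1 - exp (- \<eta>)) \<le> exp (- (K * D)) * (1 - exp (- (K * D)))"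
        by (rule mult_mono[OF 1 2]) (use \<eta> in auto)
      then show "1 - exp (- (K * D)) * (1 - exp (- (K * D))) \<le> 1 - \<delta> * \<kappa> powr \<mu>"
        by (simp add: \<delta>_def algebra_simps)
      show "0 \<le> max (section_max r1 r2 u (\<theta> - pi/2)) (section_max r1 r2 u (\<theta> + pi/2))"
        using u section_max_nonneg[of u "\<theta> + pi/2"] \<theta>' drift(1) by (simp add: solution_def le_max_iff_disj)
    qed
    finally show ?thesis unfolding \<mu>_def .
  qed
  show ?thesis
  proof (rule exI[of _ "S + 3 * (pi/2)"], rule exI[of _ "\<delta> / (pi/2)"], intro conjI allI impI)
    show "\<Theta>bar \<le> S + 3 * (pi/2)" using S pi_gt_zero by linarith
    show "0 < \<delta> / (pi/2)" using \<delta> by simp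
  next
    fix u assume "C2_on U u \<and> continuous_on (spiral_closed \<theta>0 r1 r2) u \<and>
         (\<forall>x\<in>U. drift_operator A b u x = 0) \<and> (\<forall>x\<in>spiral_sides \<theta>0 r1 r2. u x = 0)"
    then have u: "solution u" by (simp add: solution_def U_def)
    show "((\<forall>\<theta>\<ge>\<theta>0. section_max r1 r2 u \<theta> \<le> section_max r1 r2 u \<theta>0 *
            (if \<theta> < S + 3 * (pi/2) then 1
             else min 1 (exp (- (\<delta> / (pi/2)) * integral {S + 3 * (pi/2)..\<theta>} (\<lambda>\<zeta>. \<kappa> powr m \<zeta>))))) \<and>
        (section_max r1 r2 u \<longlongrightarrow> 0) at_top)
      \<or> ((\<exists>C>0. \<forall>\<^sub>F \<theta> in at_top. section_max r1 r2 u \<theta> \<ge>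
            C * exp (\<delta> / (pi/2) * integral {\<Theta>bar..\<theta>} (\<lambda>\<zeta>. \<kappa> powr m \<zeta>))) \<and>
        filterlim (section_max r1 r2 u) at_top at_top)"
      by (rule rate.quasiconvex_dichotomy)
        (use u section_max_nonneg section_max_quasiconvex contraction drift S \<delta> in \<open>auto simp: solution_def\<close>)
  qed
qed

end
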